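(* There exists a set $\mathcal{D}_0\subseteq \mathcal{S}^1$ of lower box (and hence Hausdorff) dimension zero that is universal for the class $\mathcal{C}_{AD}$ of AD-regular subsets of $\mathbb{R}^2$.
   Context: $\mathcal{S}^1$ is the unit circle in $\mathbb{R}^2$. For $e\in\mathcal{S}^1$ and $x\in\mathbb{R}^2$, $p_ex=e\cdot x$ and $p_eE=\{p_ex:x\in E\}$. A set $\mathcal{D}\subseteq\mathcal{S}^1$ is universal for a class $\mathcal{C}$ of subsets of $\mathbb{R}^2$ if for every $E\in\mathcal{C}$ there is some $e\in\mathcal{D}$ such that $\dim_H(p_eE)=\min\{\dim_H(E),1\}$, where $\dim_H$ is Hausdorff dimension. A closed set $E\subseteq\mathbb{R}^n$ is $(\alpha,C)$-AD-regular, with $\alpha\ge0$ and $C\ge1$, if $C^{-1}r^\alpha\le\mathcal{H}^\alpha(E\cap B(x,r))\le Cr^\alpha$ for all $x\in E$ and $0<r<\operatorname{diam}(E)$, where $\mathcal{H}^\alpha$ is $\alpha$-dimensional Hausdorff measure. $E$ is $\alpha$-AD-regular if it is $(\alpha,C)$-AD-regular for some $C\ge 1$, and AD-regular if it is $\alpha$-AD-regular for some $\alpha$. *)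

theory Defs
  imports "HOL-Analysis.Analysis"
begin

text \<open>
  The summand \<open>(diam U)\<^sup>s\<close> in the definition of Hausdorff measure, for bounded \<open>U\<close>. The case
  \<open>s = 0\<close> is separate because \<open>0 powr 0 = 0\<close>: nonempty sets must count 1, so that the
  0-dimensional Hausdorff measure is counting measure.
\<close>
definition diam_pow :: "real \<Rightarrow> 'a::metric_space set \<Rightarrow> ennreal" where
  "diam_pow s U =
     (if U = {} then 0 else if s = 0 then 1 else ennreal (diameter U powr s))"

text \<open>Boundedness is required explicitly since \<^const>\<open>diameter\<close> is unspecified on unbounded sets.\<close>
definition diam_covers :: "real \<Rightarrow> 'a::metric_space set \<Rightarrow> (nat \<Rightarrow> 'a set) set" where
  "diam_covers \<delta> E = {U. E \<subseteq> (\<Union>n. U n) \<and> (\<forall>n. bounded (U n) \<and> diameter (U n) \<le> \<delta>)}"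

definition hausdorff_content :: "real \<Rightarrow> real \<Rightarrow> 'a::metric_space set \<Rightarrow> ennreal" where
  "hausdorff_content s \<delta> E = (INF U \<in> diam_covers \<delta> E. \<Sum>n. diam_pow s (U n))"

definition hausdorff_measure :: "real \<Rightarrow> 'a::metric_space set \<Rightarrow> ennreal" where
  "hausdorff_measure s E = (SUP \<delta> \<in> {0<..}. hausdorff_content s \<delta> E)"

definition hausdorff_dim :: "'a::metric_space set \<Rightarrow> ennreal" where
  "hausdorff_dim E = Inf {ennreal s |s. 0 \<le> s \<and> hausdorff_measure s E = 0}"

definition covering_number :: "real \<Rightarrow> 'a::euclidean_space set \<Rightarrow> nat" where
  "covering_number \<delta> E =
     Inf {card F |F. finite F \<and> E \<subseteq> \<Union>F \<and> (\<forall>U\<in>F. bounded U \<and> diameter U \<le> \<delta>)}"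

text \<open>Unbounded sets have no finite covers of the above kind; for them the value is \<open>\<infinity>\<close>.\<close>
definition lower_box_dim :: "'a::euclidean_space set \<Rightarrow> ereal" where
  "lower_box_dim E =
     (if bounded E
      then Liminf (at_right 0) (\<lambda>\<delta>. ereal (ln (real (covering_number \<delta> E)) / - ln \<delta>))
      else \<infinity>)"

text \<open>
  The premise \<open>bounded E \<longrightarrow> r < diameter E\<close> expresses \<open>r < diam E\<close> with the convention
  \<open>diam E = \<infinity>\<close> for unbounded \<open>E\<close>. Open and closed balls give the same notion, with the same
  constant, by continuity in \<open>r\<close>.
\<close>
definition AD_regular_with :: "real \<Rightarrow> real \<Rightarrow> 'a::euclidean_space set \<Rightarrow> bool" where
  "AD_regular_with \<alpha> C E \<longleftrightarrow>
     closed E \<and> 0 \<le> \<alpha> \<and> 1 \<le> C \<and>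
     (\<forall>x\<in>E. \<forall>r>0. (bounded E \<longrightarrow> r < diameter E) \<longrightarrow>
        ennreal (inverse C * r powr \<alpha>) \<le> hausdorff_measure \<alpha> (E \<inter> ball x r) \<and>
        hausdorff_measure \<alpha> (E \<inter> ball x r) \<le> ennreal (C * r powr \<alpha>))"

definition AD_regular :: "'a::euclidean_space set \<Rightarrow> bool" where
  "AD_regular E \<longleftrightarrow> (\<exists>\<alpha> C. AD_regular_with \<alpha> C E)"

definition universal :: "(real^2) set \<Rightarrow> (real^2) set set \<Rightarrow> bool" where
  "universal D \<C> \<longleftrightarrow>
     D \<subseteq> sphere 0 1 \<and>
     (\<forall>E\<in>\<C>. \<exists>e\<in>D. hausdorff_dim ((\<lambda>x. e \<bullet> x) ` E) = min (hausdorff_dim E) 1)"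

end

theory Submission
  imports Defs "HOL-Real_Asymp.Real_Asymp"
begin

text \<open>
  \<open>D\<^sub>0\<close> consists of the directions whose angle is, for every \<open>k\<close>, within \<open>2 powr -a\<^bsub>k+1\<^esub>\<close> of the grid of
  mesh \<open>2 powr -b\<^sub>k\<close>, where \<open>b\<^sub>k = (k!)\<^sup>2\<close> and \<open>a\<^bsub>k+1\<^esub> = (k+1) b\<^sub>k\<close>; as \<open>b\<^sub>k / a\<^bsub>k+1\<^esub>\<close> tends to \<open>0\<close>, its lower
  box dimension is zero. On the other hand \<open>a\<^sub>k / b\<^sub>k\<close> tends to \<open>0\<close>, so such angles are essentially free down
  to scale \<open>2 powr -b\<^sub>k\<close>.

  The projection of a piece of \<open>E\<close> of size \<open>2 powr -l\<close>, seen at resolution \<open>2 powr -(l+b\<^sub>k)\<close>, depends on the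
  direction only up to precision \<open>2 powr -b\<^sub>k\<close>, and by regularity all such pieces look alike after
  rescaling. Marstrand's counting argument shows that for each point \<open>x\<close> and each \<open>l\<close> only a proportion
  of about \<open>2 powr -a\<^sub>k\<close> of the grid angles put too many points near \<open>x\<close> into one fibre. The levels
  \<open>l = m b\<^sub>k\<close> with \<open>k \<le> m < (k+1)\<^sup>3\<close>, \<open>k = 1, 2, \<dots>\<close>, exhaust all scales, with step \<open>b\<^sub>k\<close> negligible against \<open>l\<close>,
  and the bad proportions are summable over all of them. So for every finite net of \<open>E\<close> some angle is good at
  all levels for half of the net points, which bounds the number of net points in each fibre at each
  scale. A limit of these angles, as the nets get finer, gives the required direction.
\<close>

section \<open>Hausdorff measure\<close>

lemma diam_pow_empty [simp]: "diam_pow s {} = 0"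
  by (simp add: diam_pow_def)

lemma diam_pow_le:
  assumes "0 \<le> s" "bounded V" "bounded U" "V = {} \<longleftrightarrow> U = {}" "diameter V \<le> diameter U" 
  shows "diam_pow s V \<le> diam_pow s U"
  using assms unfolding diam_pow_def
  by (auto intro!: ennreal_leI powr_mono2 diameter_ge_0)
  
lemma diam_covers_mono:
  "E \<subseteq> F \<Longrightarrow> \<delta> \<le> \<delta>' \<Longrightarrow> diam_covers \<delta> F \<subseteq> diam_covers \<delta>' E"
  unfolding diam_covers_def by (blast intro: order_trans)

lemma hausdorff_content_mono:
  "E \<subseteq> F \<Longrightarrow> \<delta> \<le> \<delta>' \<Longrightarrow> hausdorff_content s \<delta>' E \<le> hausdorff_content s \<delta> F"
  unfolding hausdorff_content_def by (intro INF_superset_mono diam_covers_mono) auto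

lemma hausdorff_measure_mono:
  "E \<subseteq> F \<Longrightarrow> hausdorff_measure s E \<le> hausdorff_measure s F"
  unfolding hausdorff_measure_def by (intro SUP_mono) (auto intro: hausdorff_content_mono)

lemma hausdorff_content_le_measure:
  "0 < \<delta> \<Longrightarrow> hausdorff_content s \<delta> E \<le> hausdorff_measure s E"
  unfolding hausdorff_measure_def by (intro SUP_upper) auto

lemma hausdorff_content_le_sum:
  "U \<in> diam_covers \<delta> E \<Longrightarrow> hausdorff_content s \<delta> E \<le> (\<Sum>n. diam_pow s (U n))"
  unfolding hausdorff_content_def by (intro INF_lower)

lemma hausdorff_content_less_cover:
  assumes "hausdorff_content s \<delta> E < c"
  obtains U where "U \<in> diam_covers \<delta> E" "(\<Sum>n. diam_pow s (U n)) < c"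
  using assms unfolding hausdorff_content_def INF_less_iff by blast

lemma hausdorff_measure_empty [simp]: "hausdorff_measure s {} = 0"
proof -
  have "hausdorff_content s \<delta> ({} :: 'a set) \<le> 0" if "\<delta> > 0" for \<delta>
    using hausdorff_content_le_sum[of "\<lambda>_. {}" \<delta> "{}" s] that
    by (simp add: diam_covers_def)
  then show ?thesis
    by (auto simp: hausdorff_measure_def intro!: antisym SUP_least)
qed

section \<open>Countable subadditivity, and additivity over sets at positive distance\<close>

lemma hausdorff_content_UN:
  fixes A :: "nat \<Rightarrow> 'a::metric_space set"
  shows "hausdorff_content s \<delta> (\<Union>i. A i) \<le> (\<Sum>i. hausdorff_content s \<delta> (A i))"
proof (cases "(\<Sum>i. hausdorff_content s \<delta> (A i)) = top")
  case False
  show ?thesis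
  proof (rule ennreal_le_epsilon)
    fix e :: real assume e: "e > 0"
    have fin: "hausdorff_content s \<delta> (A i) \<noteq> top" for i
      using False ennreal_suminf_lessD[of "\<lambda>i. hausdorff_content s \<delta> (A i)" top i]
      by (simp add: less_top)
    have "\<exists>U. U \<in> diam_covers \<delta> (A i) \<and>
        (\<Sum>n. diam_pow s (U n)) \<le> hausdorff_content s \<delta> (A i) + ennreal (e * (1/2) ^ Suc i)" for i
    proof -
      have "hausdorff_content s \<delta> (A i) < hausdorff_content s \<delta> (A i) + ennreal (e * (1/2) ^ Suc i)"
        using fin[of i] e by (cases "hausdorff_content s \<delta> (A i)") (auto simp flip: ennreal_plus simp: ennreal_less_iff)
      then show ?thesis
        by (elim hausdorff_content_less_cover) (blast intro: less_imp_le)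
    qed
    then obtain U where U: "\<And>i. U i \<in> diam_covers \<delta> (A i)"
      "\<And>i. (\<Sum>n. diam_pow s (U i n)) \<le> hausdorff_content s \<delta> (A i) + ennreal (e * (1/2) ^ Suc i)"
      by metis
    define V where "V n = case_prod U (prod_decode n)" for n
    have VU: "V (prod_encode (i, n)) = U i n" for i n
      by (simp add: V_def)
    have "V \<in> diam_covers \<delta> (\<Union>i. A i)"
    proof -
      have "x \<in> (\<Union>n. V n)" if "x \<in> A i" for x i
      proof -
        obtain n where "x \<in> U i n" using U(1)[of i] \<open>x \<in> A i\<close> by (auto simp: diam_covers_def)
        then show ?thesis using VU by blast
      qed
      then show ?thesis using U(1) by (auto simp: diam_covers_def V_def split: prod.split)
    qed
    then have "hausdorff_content s \<delta> (\<Union>i. A i) \<le> (\<Sum>n. diam_pow s (V n))"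
      by (rule hausdorff_content_le_sum)
    also have "\<dots> = (\<Sum>i. \<Sum>n. diam_pow s (U i n))"
      using suminf_ennreal_2dimen[of "\<lambda>i. \<Sum>n. diam_pow s (U i n)" "\<lambda>p. diam_pow s (case_prod U p)"]
      by (simp add: V_def comp_def)
    also have "\<dots> \<le> (\<Sum>i. hausdorff_content s \<delta> (A i) + ennreal (e * (1/2) ^ Suc i))"
      by (intro suminf_le U(2)) auto
    also have "\<dots> = (\<Sum>i. hausdorff_content s \<delta> (A i)) + (\<Sum>i. ennreal (e * (1/2) ^ Suc i))"
      by (intro suminf_add[symmetric]) auto
    also have "(\<Sum>i. ennreal (e * (1/2) ^ Suc i)) = ennreal e"
      using e sums_mult[OF power_half_series, of e] by (intro suminf_ennreal_eq) auto
    finally show "hausdorff_content s \<delta> (\<Union>i. A i) \<le> (\<Sum>i. hausdorff_content s \<delta> (A i)) + ennreal e" .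
  qed
qed simp

lemma hausdorff_measure_UN:
  fixes A :: "nat \<Rightarrow> 'a::metric_space set"
  shows "hausdorff_measure s (\<Union>i. A i) \<le> (\<Sum>i. hausdorff_measure s (A i))"
  unfolding hausdorff_measure_def[of s "\<Union>i. A i"]
proof (rule SUP_least)
  fix \<delta> :: real assume "\<delta> \<in> {0<..}"
  then have "(\<Sum>i. hausdorff_content s \<delta> (A i)) \<le> (\<Sum>i. hausdorff_measure s (A i))"
    by (intro suminf_le hausdorff_content_le_measure) auto
  with hausdorff_content_UN[of s \<delta> A]
  show "hausdorff_content s \<delta> (\<Union>i. A i) \<le> (\<Sum>i. hausdorff_measure s (A i))" by (rule order_trans)
qed

lemma hausdorff_measure_Un:
  "hausdorff_measure s (A \<union> B) \<le> hausdorff_measure s A + hausdorff_measure s B"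
proof -
  define f where "f i = (if i = 0 then A else if i = 1 then B else {})" for i :: nat
  have "A \<union> B \<subseteq> (\<Union>i. f i)"
    using UN_upper[of 0 UNIV f] UN_upper[of 1 UNIV f] by (simp add: f_def)
  then have "hausdorff_measure s (A \<union> B) \<le> hausdorff_measure s (\<Union>i. f i)"
    by (rule hausdorff_measure_mono)
  also have "\<dots> \<le> (\<Sum>i. hausdorff_measure s (f i))" by (rule hausdorff_measure_UN)
  also have "\<dots> = (\<Sum>i\<in>{0,1}. hausdorff_measure s (f i))"
    by (intro suminf_finite) (auto simp: f_def)
  finally show ?thesis by (simp add: f_def)
qed

lemma hausdorff_measure_UN_finite:
  "finite I \<Longrightarrow> hausdorff_measure s (\<Union>i\<in>I. A i) \<le> (\<Sum>i\<in>I. hausdorff_measure s (A i))"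
proof (induction I rule: finite_induct)
  case (insert i I)
  then show ?case
    using hausdorff_measure_Un[of s "A i" "\<Union>i\<in>I. A i"]
    by (simp add: add_left_mono order_trans)
qed simp

lemma hausdorff_measure_UN_null:
  assumes "countable I" "\<And>i. i \<in> I \<Longrightarrow> hausdorff_measure s (A i) = 0"
  shows "hausdorff_measure s (\<Union>i\<in>I. A i) = 0"
proof (cases "I = {}")
  case False
  then have "(\<Union>i\<in>I. A i) = (\<Union>n. A (from_nat_into I n))"
    using range_from_nat_into[OF False assms(1)] by (metis image_image)
  moreover have "hausdorff_measure s (A (from_nat_into I n)) = 0" for n
    using assms(2) from_nat_into[OF False] by auto
  ultimately show ?thesis
    using hausdorff_measure_UN[of s "\<lambda>n. A (from_nat_into I n)"] by simp
qed simp

text \<open>A set of diameter at most \<open>\<delta>\<close> cannot meet both \<open>A\<close> and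
  \<open>B\<close>, so any cover of the union splits into a cover of \<open>A\<close> and a cover of
  \<open>B\<close>, no index serving both.\<close>

lemma hausdorff_content_separated:
  assumes "\<And>x y. x \<in> A \<Longrightarrow> y \<in> B \<Longrightarrow> \<delta> < dist x y"
  shows "hausdorff_content s \<delta> A + hausdorff_content s \<delta> B \<le> hausdorff_content s \<delta> (A \<union> B)"
  unfolding hausdorff_content_def[of s \<delta> "A \<union> B"]
proof (rule INF_greatest)
  fix U assume U: "U \<in> diam_covers \<delta> (A \<union> B)"
  define V where "V C n = (if U n \<inter> C = {} then {} else U n)" for C n
  have "V C \<in> diam_covers \<delta> C" if "C \<subseteq> A \<union> B" for C
  proof -
    \<comment> \<open>Discarded members are replaced by the empty set, whose diameter 0 is
      admissible because \<open>\<delta>\<close> is nonnegative.\<close>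
    have "0 \<le> \<delta>" using U diameter_ge_0[of "U 0"] by (auto simp: diam_covers_def intro: order_trans)
    then show ?thesis
    using U that by (fastforce simp: diam_covers_def V_def)
  qed
  then have "hausdorff_content s \<delta> A + hausdorff_content s \<delta> B
      \<le> (\<Sum>n. diam_pow s (V A n)) + (\<Sum>n. diam_pow s (V B n))"
    by (intro add_mono hausdorff_content_le_sum) auto
  also have "\<dots> = (\<Sum>n. diam_pow s (V A n) + diam_pow s (V B n))"
    by (intro suminf_add) auto
  also have "\<dots> \<le> (\<Sum>n. diam_pow s (U n))"
  proof (intro suminf_le)
    fix n
    have "U n \<inter> A = {} \<or> U n \<inter> B = {}"
    proof (rule ccontr)
      assume "\<not> ?thesis"
      then obtain x y where "x \<in> U n" "x \<in> A" "y \<in> U n" "y \<in> B" by blast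
      moreover have "bounded (U n)" "diameter (U n) \<le> \<delta>" using U by (auto simp: diam_covers_def)
      ultimately show False
        using assms[of x y] diameter_bounded_bound[of "U n" x y] by simp
    qed
    then show "diam_pow s (V A n) + diam_pow s (V B n) \<le> diam_pow s (U n)"
      by (auto simp: V_def)
  qed auto
  finally show "hausdorff_content s \<delta> A + hausdorff_content s \<delta> B \<le> (\<Sum>n. diam_pow s (U n))" .
qed

lemma hausdorff_measure_separated:
  assumes d: "d > 0" and sep: "\<And>x y. x \<in> A \<Longrightarrow> y \<in> B \<Longrightarrow> d \<le> dist x y"
  shows "hausdorff_measure s A + hausdorff_measure s B \<le> hausdorff_measure s (A \<union> B)"
proof -
  \<comment> \<open>Contents grow as \<open>\<delta>\<close> shrinks, so both suprema can be taken
    along a common \<open>\<delta>\<close>.\<close>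
  have "hausdorff_measure s A + hausdorff_measure s B =
      (SUP \<delta>\<in>{0<..}. hausdorff_content s \<delta> A + hausdorff_content s \<delta> B)"
    unfolding hausdorff_measure_def
  proof (rule SUP_add_directed_ennreal[symmetric])
    fix i j :: real assume "i \<in> {0<..}" "j \<in> {0<..}"
    then show "\<exists>k\<in>{0<..}. hausdorff_content s i A + hausdorff_content s j B
        \<le> hausdorff_content s k A + hausdorff_content s k B"
      by (intro bexI[of _ "min i j"] add_mono hausdorff_content_mono) auto
  qed
  also have "\<dots> \<le> hausdorff_measure s (A \<union> B)"
  proof (rule SUP_least)
    fix \<delta> :: real assume "\<delta> \<in> {0<..}"
    define \<delta>' where "\<delta>' = min \<delta> (d/2)"
    have "hausdorff_content s \<delta> A + hausdorff_content s \<delta> B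
        \<le> hausdorff_content s \<delta>' A + hausdorff_content s \<delta>' B"
      by (intro add_mono hausdorff_content_mono) (auto simp: \<delta>'_def)
    also have "\<dots> \<le> hausdorff_content s \<delta>' (A \<union> B)"
    proof (rule hausdorff_content_separated)
      show "\<delta>' < dist x y" if "x \<in> A" "y \<in> B" for x y
        using sep[OF that] d by (auto simp: \<delta>'_def min_def)
    qed
    also have "\<dots> \<le> hausdorff_measure s (A \<union> B)"
      using d \<open>\<delta> \<in> _\<close> by (intro hausdorff_content_le_measure) (auto simp: \<delta>'_def)
    finally show "hausdorff_content s \<delta> A + hausdorff_content s \<delta> B \<le> hausdorff_measure s (A \<union> B)" .
  qed
  finally show ?thesis .
qed

lemma hausdorff_measure_separated_UN:
  assumes "finite I" "d > 0"
    and "\<And>i j x y. i \<in> I \<Longrightarrow> j \<in> I \<Longrightarrow> i \<noteq> j \<Longrightarrow> x \<in> A i \<Longrightarrow> y \<in> A j \<Longrightarrow> d \<le> dist x y"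
  shows "(\<Sum>i\<in>I. hausdorff_measure s (A i)) \<le> hausdorff_measure s (\<Union>i\<in>I. A i)"
  using assms(1,3)
proof (induction I rule: finite_induct)
  case (insert i I)
  have "hausdorff_measure s (A i) + hausdorff_measure s (\<Union>i\<in>I. A i)
      \<le> hausdorff_measure s (A i \<union> (\<Union>i\<in>I. A i))"
    using insert.hyps insert.prems by (intro hausdorff_measure_separated[OF assms(2)]) blast
  moreover have "(\<Sum>i\<in>I. hausdorff_measure s (A i)) \<le> hausdorff_measure s (\<Union>i\<in>I. A i)"
    using insert.prems by (intro insert.IH) blast
  ultimately show ?case
    using insert.hyps by (auto intro: order_trans[OF add_left_mono])
qed simp

text \<open>When all diameters are at most \<open>\<delta>\<close>, passing from s-th to t-th powers
  gains the factor \<open>\<delta> powr (t - s)\<close>, which tends to 0.\<close>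

lemma hausdorff_measure_null_of_finite:
  fixes E :: "'a::metric_space set"
  assumes "0 \<le> s" "s < t" "hausdorff_measure s E < top"
  shows "hausdorff_measure t E = 0"
proof -
  obtain c where c: "hausdorff_measure s E = ennreal c" "0 \<le> c"
    using assms(3) by (auto simp: less_top_ennreal)
  have content: "hausdorff_content t \<delta> E \<le> ennreal (\<delta> powr (t - s) * (c + 1))" if \<delta>: "0 < \<delta>" for \<delta>
  proof -
    have "hausdorff_content s \<delta> E < ennreal (c + 1)"
      using hausdorff_content_le_measure[OF \<delta>, of s E] c by (auto intro: order.strict_trans1 simp: ennreal_less_iff)
    then obtain U where U: "U \<in> diam_covers \<delta> E" "(\<Sum>n. diam_pow s (U n)) < ennreal (c + 1)"
      by (rule hausdorff_content_less_cover)
    have "diam_pow t (U n) \<le> ennreal (\<delta> powr (t - s)) * diam_pow s (U n)" for n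
    proof -
      have d: "0 \<le> diameter (U n)" "diameter (U n) \<le> \<delta>"
        using U(1) by (auto simp: diam_covers_def diameter_ge_0)
      have "diameter (U n) powr t \<le> \<delta> powr (t - s) * diameter (U n) powr s"
      proof -
        have "diameter (U n) powr t = diameter (U n) powr (t - s) * diameter (U n) powr s"
          by (simp flip: powr_add)
        also have "\<dots> \<le> \<delta> powr (t - s) * diameter (U n) powr s"
          using d assms by (intro mult_right_mono powr_mono2) auto
        finally show ?thesis .
      qed
      \<comment> \<open>This is for s = 0, where \<open>diam_pow\<close> counts 1 instead of a power
        of the diameter.\<close>
      moreover have "diameter (U n) powr t \<le> \<delta> powr t"
        using d assms by (intro powr_mono2) auto
      ultimately show ?thesis
        using assms(1,2) by (auto simp: diam_pow_def ennreal_leI simp flip: ennreal_mult)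
    qed
    then have "(\<Sum>n. diam_pow t (U n)) \<le> (\<Sum>n. ennreal (\<delta> powr (t - s)) * diam_pow s (U n))"
      by (intro suminf_le) auto
    also have "\<dots> = ennreal (\<delta> powr (t - s)) * (\<Sum>n. diam_pow s (U n))"
      by simp
    also have "\<dots> \<le> ennreal (\<delta> powr (t - s)) * ennreal (c + 1)"
      using U(2) by (intro mult_left_mono) auto
    finally show ?thesis
      using hausdorff_content_le_sum[OF U(1), of t] c(2) by (simp add: ennreal_mult order_trans)
  qed
  have "hausdorff_content t \<delta> E \<le> 0" if \<delta>: "0 < \<delta>" for \<delta>
  proof (rule ennreal_le_epsilon)
    fix e :: real assume e: "0 < e"
    define \<delta>' where "\<delta>' = min \<delta> ((e / (c + 1)) powr (1 / (t - s)))"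
    have "0 < \<delta>'" using \<delta> e c by (simp add: \<delta>'_def)
    have "\<delta>' powr (t - s) \<le> ((e / (c + 1)) powr (1 / (t - s))) powr (t - s)"
      using \<open>0 < \<delta>'\<close> assms by (intro powr_mono2) (auto simp: \<delta>'_def)
    also have "\<dots> = e / (c + 1)"
      using assms c e by (simp add: powr_powr)
    finally have "\<delta>' powr (t - s) * (c + 1) \<le> e"
      using c by (simp add: pos_le_divide_eq)
    then have "hausdorff_content t \<delta>' E \<le> ennreal e"
      using content[OF \<open>0 < \<delta>'\<close>] by (meson ennreal_leI order_trans)
    moreover have "hausdorff_content t \<delta> E \<le> hausdorff_content t \<delta>' E"
      by (intro hausdorff_content_mono) (auto simp: \<delta>'_def)
    ultimately show "hausdorff_content t \<delta> E \<le> 0 + ennreal e" by simp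
  qed
  then show ?thesis
    unfolding hausdorff_measure_def by (intro antisym SUP_least) auto
qed

text \<open>The form in which covering numbers bound dimensions from above: finitely many sets with
  one common bound \<open>\<rho>\<close> for the diameters. The value 0 is allowed for
  \<open>\<rho>\<close>, which disposes of single points.\<close>

lemma hausdorff_measure_null_finite_covers:
  fixes E :: "'a::metric_space set"
  assumes s: "0 < s"
    and cover: "\<And>\<epsilon> \<delta>. 0 < \<epsilon> \<Longrightarrow> 0 < \<delta> \<Longrightarrow> \<exists>\<rho> F. \<rho> \<le> \<delta> \<and> finite F \<and> E \<subseteq> \<Union>F \<and>
        (\<forall>U\<in>F. bounded U \<and> diameter U \<le> \<rho>) \<and> real (card F) * \<rho> powr s \<le> \<epsilon>"
  shows "hausdorff_measure s E = 0"
proof -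
  have "hausdorff_content s \<delta> E \<le> 0" if \<delta>: "0 < \<delta>" for \<delta>
  proof (rule ennreal_le_epsilon)
    fix e :: real assume e: "0 < e"
    obtain \<rho> F where F: "\<rho> \<le> \<delta>" "finite F" "E \<subseteq> \<Union>F"
        "\<forall>U\<in>F. bounded U \<and> diameter U \<le> \<rho>" "real (card F) * \<rho> powr s \<le> e"
      using cover[OF e \<delta>] by blast
    obtain f where f: "bij_betw f {..<card F} F"
      using bij_betw_from_nat_into_finite[OF F(2)] by blast
    define U where "U n = (if n < card F then f n else {})" for n
    have UF: "n < card F \<Longrightarrow> U n \<in> F" for n
      using f by (auto simp: U_def bij_betw_def)
    have "(\<Union>n. U n) = \<Union>F"
      using f by (auto simp: U_def bij_betw_def split: if_splits)
    moreover have "bounded (U n) \<and> diameter (U n) \<le> \<delta>" for n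
      using UF[of n] F(1,4) \<delta> by (cases "n < card F") (auto simp: U_def)
    ultimately have "U \<in> diam_covers \<delta> E"
      using F(3) by (auto simp: diam_covers_def)
    then have "hausdorff_content s \<delta> E \<le> (\<Sum>n. diam_pow s (U n))"
      by (rule hausdorff_content_le_sum)
    also have "\<dots> = (\<Sum>n<card F. diam_pow s (U n))"
      by (intro suminf_finite) (auto simp: U_def)
    also have "\<dots> \<le> (\<Sum>n<card F. ennreal (\<rho> powr s))"
    proof (intro sum_mono)
      fix n assume "n \<in> {..<card F}"
      then show "diam_pow s (U n) \<le> ennreal (\<rho> powr s)"
        using UF[of n] F(4) s by (auto simp: diam_pow_def intro!: ennreal_leI powr_mono2 diameter_ge_0)
    qed
    also have "\<dots> = ennreal (real (card F) * \<rho> powr s)"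
      by (simp add: ennreal_mult' ennreal_of_nat_eq_real_of_nat)
    finally show "hausdorff_content s \<delta> E \<le> 0 + ennreal e"
      using F(5) by (simp add: ennreal_leI order_trans)
  qed
  then show ?thesis
    unfolding hausdorff_measure_def by (intro antisym SUP_least) auto
qed

section \<open>Bounds for the Hausdorff dimension\<close>

lemma hausdorff_dim_le:
  assumes "0 \<le> \<alpha>" "\<And>t. \<alpha> < t \<Longrightarrow> hausdorff_measure t E = 0"
  shows "hausdorff_dim E \<le> ennreal \<alpha>"
proof (rule ennreal_le_epsilon)
  fix e :: real assume "0 < e"
  then have "hausdorff_dim E \<le> ennreal (\<alpha> + e)"
    unfolding hausdorff_dim_def using assms by (intro Inf_lower CollectI exI[of _ "\<alpha> + e"]) auto
  then show "hausdorff_dim E \<le> ennreal \<alpha> + ennreal e"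
    using assms(1) \<open>0 < e\<close> by simp
qed

lemma le_hausdorff_dim:
  assumes "\<And>t. 0 < t \<Longrightarrow> t < s \<Longrightarrow> hausdorff_measure t E \<noteq> 0"
  shows "ennreal s \<le> hausdorff_dim E"
  unfolding hausdorff_dim_def
proof (rule Inf_greatest)
  fix z assume "z \<in> {ennreal t |t. 0 \<le> t \<and> hausdorff_measure t E = 0}"
  then obtain t where t: "z = ennreal t" "0 \<le> t" "hausdorff_measure t E = 0" by blast
  have "s \<le> t"
  proof (rule ccontr)
    assume "\<not> s \<le> t"
    \<comment> \<open>The midpoint is taken because t itself may be 0, and the hypothesis speaks of
      positive exponents only.\<close>
    then have "hausdorff_measure ((t + s) / 2) E = 0"
      using t by (intro hausdorff_measure_null_of_finite[of t]) auto
    then show False using assms[of "(t + s) / 2"] \<open>\<not> s \<le> t\<close> t by auto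
  qed
  then show "ennreal s \<le> z" using t by (simp add: ennreal_leI)
qed

lemma hausdorff_measure_lipschitz:
  fixes f :: "'a::metric_space \<Rightarrow> 'b::metric_space"
  assumes s: "0 \<le> s" and f: "\<And>x y. dist (f x) (f y) \<le> dist x y"
  shows "hausdorff_measure s (f ` E) \<le> hausdorff_measure s E"
  unfolding hausdorff_measure_def
proof (rule SUP_mono)
  fix \<delta> :: real assume "\<delta> \<in> {0<..}"
  have "hausdorff_content s \<delta> (f ` E) \<le> hausdorff_content s \<delta> E"
    unfolding hausdorff_content_def[of s \<delta> E]
  proof (rule INF_greatest)
    fix U assume U: "U \<in> diam_covers \<delta> E"
    then have bU: "bounded (U n)" "diameter (U n) \<le> \<delta>" for n by (auto simp: diam_covers_def)
    have b: "dist (f x) (f y) \<le> diameter (U n)" if "x \<in> U n" "y \<in> U n" for x y n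
      using f[of x y] diameter_bounded_bound[OF bU(1) that] by simp
    have bf: "bounded (f ` U n)" for n
    proof (cases "U n = {}")
      case False
      then obtain x where "x \<in> U n" by blast
      then show ?thesis
        using b unfolding bounded_def by blast
    qed simp
    have df: "diameter (f ` U n) \<le> diameter (U n)" for n
      using b[of _ n] by (cases "U n = {}") (auto simp: diameter_def intro!: cSUP_least)
    have "(\<lambda>n. f ` U n) \<in> diam_covers \<delta> (f ` E)"
      using U bf df order_trans[OF df bU(2)] unfolding diam_covers_def by blast
    then have "hausdorff_content s \<delta> (f ` E) \<le> (\<Sum>n. diam_pow s (f ` U n))"
      by (rule hausdorff_content_le_sum)
    also have "\<dots> \<le> (\<Sum>n. diam_pow s (U n))"
      using s df bf bU by (intro suminf_le diam_pow_le) auto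
    finally show "hausdorff_content s \<delta> (f ` E) \<le> (\<Sum>n. diam_pow s (U n))" .
  qed
  then show "\<exists>\<delta>'\<in>{0<..}. hausdorff_content s \<delta> (f ` E) \<le> hausdorff_content s \<delta>' E"
    using \<open>\<delta> \<in> _\<close> by blast
qed

lemma hausdorff_dim_lipschitz:
  assumes "\<And>x y. dist (f x) (f y) \<le> dist x y"
  shows "hausdorff_dim (f ` E) \<le> hausdorff_dim E"
  unfolding hausdorff_dim_def
proof (rule Inf_superset_mono, safe)
  fix s :: real assume "0 \<le> s" "hausdorff_measure s E = 0"
  then show "\<exists>s'. ennreal s = ennreal s' \<and> 0 \<le> s' \<and> hausdorff_measure s' (f ` E) = 0"
    using hausdorff_measure_lipschitz[of s f E, OF _ assms] by (intro exI[of _ s]) auto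
qed

text \<open>A unit interval is covered by n + 1 intervals of length 1/n, and n + 1 is o(n^t) for t >
  1; the line is a countable union of unit intervals.\<close>

lemma hausdorff_dim_real_le_1: "hausdorff_dim (A :: real set) \<le> 1"
proof -
  have unit: "hausdorff_measure t {a..a + 1} = 0" if t: "1 < t" for t a :: real
  proof (rule hausdorff_measure_null_finite_covers)
    fix \<epsilon> \<delta> :: real assume "0 < \<epsilon>" "0 < \<delta>"
    have "(\<lambda>n. (real n + 1) * (1 / real n) powr t) \<longlonglongrightarrow> 0" "(\<lambda>n. 1 / real n) \<longlonglongrightarrow> 0"
      using t by real_asymp+
    then have "\<forall>\<^sub>F n in sequentially. (real n + 1) * (1 / real n) powr t < \<epsilon> \<and> 1 / real n < \<delta> \<and> 0 < n"
      using \<open>0 < \<epsilon>\<close> \<open>0 < \<delta>\<close> by (auto intro!: eventually_conj order_tendstoD eventually_gt_at_top)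
    then obtain n :: nat where n: "(real n + 1) * (1 / real n) powr t < \<epsilon>" "1 / real n < \<delta>" "0 < n"
      by (metis (no_types, lifting) eventually_happens' sequentially_bot)
    define I where "I i = {a + real i / real n .. a + (real i + 1) / real n}" for i
    have cov: "{a..a + 1} \<subseteq> \<Union>(I ` {..n})"
    proof
      fix x assume x: "x \<in> {a..a + 1}"
      then have "0 \<le> (x - a) * n" "(x - a) * n \<le> n" by (auto intro: mult_left_le_one_le)
      then have "nat \<lfloor>(x - a) * n\<rfloor> \<in> {..n}" "x \<in> I (nat \<lfloor>(x - a) * n\<rfloor>)"
        using n(3) floor_correct[of "(x - a) * n"] by (auto simp: I_def field_simps le_nat_iff nat_le_iff floor_le_iff)
      then show "x \<in> \<Union>(I ` {..n})" by blast
    qed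
    have diam: "bounded (I i) \<and> diameter (I i) \<le> 1 / n" for i
      using n(3) by (auto simp: I_def diameter_closed_interval field_simps)
    have "real (card (I ` {..n})) \<le> real n + 1"
      using card_image_le[of "{..n}" I] by simp
    then have "real (card (I ` {..n})) * (1 / n) powr t \<le> (real n + 1) * (1 / real n) powr t"
      by (intro mult_right_mono) auto
    then have "real (card (I ` {..n})) * (1 / n) powr t \<le> \<epsilon>" using n(1) by linarith
    then show "\<exists>\<rho> F. \<rho> \<le> \<delta> \<and> finite F \<and> {a..a + 1} \<subseteq> \<Union>F \<and>
        (\<forall>U\<in>F. bounded U \<and> diameter U \<le> \<rho>) \<and> real (card F) * \<rho> powr t \<le> \<epsilon>"
      using cov diam n(2) by (intro exI[of _ "1 / n"] exI[of _ "I ` {..n}"]) auto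
  qed (use t in auto)
  have "hausdorff_measure t A = 0" if t: "1 < t" for t
  proof -
    have "A \<subseteq> (\<Union>a\<in>(\<int>::real set). {a..a + 1})"
    proof
      fix x assume "x \<in> A"
      then show "x \<in> (\<Union>a\<in>(\<int>::real set). {a..a + 1})"
        using floor_correct[of x] by (intro UN_I[of "of_int \<lfloor>x\<rfloor>"]) auto
    qed
    moreover have "countable (\<int>::real set)" by (simp add: Ints_def)
    ultimately show ?thesis
      using hausdorff_measure_UN_null[of \<int> t "\<lambda>a. {a..a + 1}"] unit[OF t]
        hausdorff_measure_mono by (metis le_zero_eq)
  qed
  then show ?thesis using hausdorff_dim_le[of 1 A] by simp
qed

section \<open>Separated nets and AD-regular sets\<close>

definition separated :: "real \<Rightarrow> 'a::metric_space set \<Rightarrow> bool" where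
  "separated \<delta> Y \<longleftrightarrow> (\<forall>x\<in>Y. \<forall>y\<in>Y. x \<noteq> y \<longrightarrow> \<delta> \<le> dist x y)"

text \<open>A separated set of the largest possible cardinality is a net, since any point far from
  it could be added.\<close>

lemma ex_separated_net:
  fixes S :: "'a::metric_space set"
  assumes "0 < \<delta>"
    and bound: "\<And>Y. finite Y \<Longrightarrow> Y \<subseteq> S \<Longrightarrow> separated \<delta> Y \<Longrightarrow> real (card Y) \<le> N"
  obtains Y where "finite Y" "Y \<subseteq> S" "separated \<delta> Y" "\<And>x. x \<in> S \<Longrightarrow> \<exists>y\<in>Y. dist x y < \<delta>"
proof -
  define P where "P n \<longleftrightarrow> (\<exists>Y. finite Y \<and> Y \<subseteq> S \<and> separated \<delta> Y \<and> card Y = n)" for n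
  have "P 0" unfolding P_def by (intro exI[of _ "{}"]) (auto simp: separated_def)
  moreover have "n \<le> nat \<lfloor>N\<rfloor>" if "P n" for n
    using bound that unfolding P_def by (auto simp: le_nat_floor)
  ultimately have "P (Greatest P)" and max: "\<And>n. P n \<Longrightarrow> n \<le> Greatest P"
    by (auto intro: GreatestI_nat Greatest_le_nat)
  then obtain Y where Y: "finite Y" "Y \<subseteq> S" "separated \<delta> Y" "card Y = Greatest P"
    unfolding P_def by blast
  have "\<exists>y\<in>Y. dist x y < \<delta>" if x: "x \<in> S" for x
  proof (rule ccontr)
    assume "\<not> ?thesis"
    then have far: "\<delta> \<le> dist x y" if "y \<in> Y" for y using that by force
    then have "x \<notin> Y" using \<open>0 < \<delta>\<close> by force
    moreover have "separated \<delta> (insert x Y)"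
      using Y(3) far by (auto simp: separated_def dist_commute)
    then have "P (card (insert x Y))"
      using Y x unfolding P_def by blast
    ultimately show False using max[of "Suc (card Y)"] Y by simp
  qed
  with Y that show thesis by blast
qed

text \<open>Regularity in discrete form. It enters the choice of the direction only through these
  two counting bounds, on separated points in a ball and on covers.\<close>

locale regular_piece =
  fixes S :: "'a::euclidean_space set" and \<alpha> A c :: real
  assumes compact: "compact S" and nonempty: "S \<noteq> {}"
    and pos: "0 < \<alpha>" "1 \<le> A" "0 < c"
    and upper: "\<And>x \<delta> r Y. \<lbrakk>x \<in> S; 0 < \<delta>; \<delta> \<le> r; finite Y; Y \<subseteq> S \<inter> cball x r; separated \<delta> Y\<rbrakk>
      \<Longrightarrow> real (card Y) \<le> A * (r / \<delta>) powr \<alpha>"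
    and lower: "\<And>\<delta> X. \<lbrakk>0 < \<delta>; finite X; X \<subseteq> S; S \<subseteq> (\<Union>x\<in>X. cball x \<delta>)\<rbrakk>
      \<Longrightarrow> c * \<delta> powr (-\<alpha>) \<le> real (card X)"

text \<open>For a set with at most one point the regularity condition is vacuous, as no positive r
  is below its diameter 0. Two distinct points give a nonempty range of radii.\<close>

lemma AD_regular_withE:
  fixes E :: "'a::euclidean_space set"
  assumes "AD_regular_with \<alpha> C E" "x0 \<in> E" "x1 \<in> E" "x0 \<noteq> x1"
  obtains R where "0 < R"
    "\<And>x r. x \<in> E \<Longrightarrow> 0 < r \<Longrightarrow> r < R \<Longrightarrow> ennreal (inverse C * r powr \<alpha>) \<le> hausdorff_measure \<alpha> (E \<inter> ball x r)"
    "\<And>x r. x \<in> E \<Longrightarrow> 0 < r \<Longrightarrow> r < R \<Longrightarrow> hausdorff_measure \<alpha> (E \<inter> ball x r) \<le> ennreal (C * r powr \<alpha>)"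
proof -
  define R where "R = (if bounded E then diameter E else 1)"
  have "0 < dist x0 x1" using assms(4) by simp
  then have "0 < diameter E" if "bounded E"
    by (rule order.strict_trans2[OF _ diameter_bounded_bound[OF that assms(2,3)]])
  then have "0 < R" by (simp add: R_def)
  then show thesis
    using assms(1) by (intro that[of R]) (auto simp: AD_regular_with_def R_def split: if_splits)
qed

text \<open>The piece is \<open>E\<close> in a ball of radius R/8, so small that every ball compared
  below has radius less than R. Both bounds compare measures: disjoint small balls in a larger one
  for \<open>upper\<close>, small balls covering a fixed one for \<open>lower\<close>.\<close>

lemma AD_regular_ex_piece:
  fixes E :: "'a::euclidean_space set"
  assumes AD: "AD_regular_with \<alpha> C E" and \<alpha>: "0 < \<alpha>" and E: "x0 \<in> E" "x1 \<in> E" "x0 \<noteq> x1"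
  obtains S A c where "S \<subseteq> E" "regular_piece S \<alpha> A c"
proof -
  have C: "1 \<le> C" and "closed E" using AD by (auto simp: AD_regular_with_def)
  obtain R where R: "0 < R"
    and lo: "\<And>x r. x \<in> E \<Longrightarrow> 0 < r \<Longrightarrow> r < R \<Longrightarrow> ennreal (inverse C * r powr \<alpha>) \<le> hausdorff_measure \<alpha> (E \<inter> ball x r)"
    and up: "\<And>x r. x \<in> E \<Longrightarrow> 0 < r \<Longrightarrow> r < R \<Longrightarrow> hausdorff_measure \<alpha> (E \<inter> ball x r) \<le> ennreal (C * r powr \<alpha>)"
    using AD_regular_withE[OF AD E] by blast
  define \<rho> where "\<rho> = R / 8"
  have \<rho>: "0 < \<rho>" using R by (simp add: \<rho>_def)
  define S where "S = E \<inter> cball x0 \<rho>"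
  define A where "A = C\<^sup>2 * 6 powr \<alpha>"
  define c where "c = inverse (C\<^sup>2) * (\<rho> / 2) powr \<alpha>"
  have "1 * 1 \<le> C\<^sup>2 * 6 powr \<alpha>" using C \<alpha> by (intro mult_mono ge_one_powr_ge_zero) auto
  then have A1: "1 \<le> A" by (simp add: A_def)
  have c0: "0 < c" using C \<rho> by (simp add: c_def)
  have diamS: "dist x y \<le> 2 * \<rho>" if "x \<in> S" "y \<in> S" for x y
    using that dist_triangle[of x y x0] by (auto simp: S_def dist_commute)

  have upper0: "real (card Y) \<le> A * (r / \<delta>) powr \<alpha>"
    if "x \<in> E" "0 < \<delta>" "\<delta> \<le> r" "r \<le> 2 * \<rho>" "finite Y" "Y \<subseteq> E \<inter> cball x r" "separated \<delta> Y" for x \<delta> r Y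
  proof -
    \<comment> \<open>The balls of radius \<open>\<delta> / 3\<close> around \<open>Y\<close> are at
      positive distance from each other, so their measures add up, and they lie in a ball of radius
      \<open>2 * r\<close>. The ratio of the two radii is the origin of the 6 in
      \<open>A\<close>.\<close>
    have "(\<Sum>y\<in>Y. ennreal (inverse C * (\<delta> / 3) powr \<alpha>)) \<le> (\<Sum>y\<in>Y. hausdorff_measure \<alpha> (E \<inter> ball y (\<delta> / 3)))"
      using that R by (intro sum_mono lo) (auto simp: \<rho>_def)
    also have "\<dots> \<le> hausdorff_measure \<alpha> (\<Union>y\<in>Y. E \<inter> ball y (\<delta> / 3))"
    proof (rule hausdorff_measure_separated_UN[of _ "\<delta> / 3"])
      fix i j x y assume ij: "i \<in> Y" "j \<in> Y" "i \<noteq> j" "x \<in> E \<inter> ball i (\<delta> / 3)" "y \<in> E \<inter> ball j (\<delta> / 3)"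
      then have "\<delta> \<le> dist i j" using that by (auto simp: separated_def)
      also have "\<dots> \<le> dist i x + dist x y + dist y j"
        using dist_triangle[of i j x] dist_triangle[of x j y] by linarith
      finally show "\<delta> / 3 \<le> dist x y" using ij by (auto simp: dist_commute)
    qed (use that in auto)
    also have "\<dots> \<le> hausdorff_measure \<alpha> (E \<inter> ball x (2 * r))"
    proof (intro hausdorff_measure_mono subsetI)
      fix z assume "z \<in> (\<Union>y\<in>Y. E \<inter> ball y (\<delta> / 3))"
      then obtain y where y: "y \<in> Y" "z \<in> E" "dist y z < \<delta> / 3" by auto
      have "dist x z \<le> dist x y + dist y z" by (rule dist_triangle)
      also have "\<dots> < r + \<delta> / 3" using y that by auto
      finally show "z \<in> E \<inter> ball x (2 * r)" using y that by auto
    qed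
    also have "\<dots> \<le> ennreal (C * (2 * r) powr \<alpha>)"
      using that R by (intro up) (auto simp: \<rho>_def)
    finally have "ennreal (real (card Y) * (inverse C * (\<delta> / 3) powr \<alpha>)) \<le> ennreal (C * (2 * r) powr \<alpha>)"
      using C by (simp add: ennreal_mult' ennreal_of_nat_eq_real_of_nat)
    then have "real (card Y) * (inverse C * (\<delta> / 3) powr \<alpha>) \<le> C * (2 * r) powr \<alpha>"
      using C by (subst (asm) ennreal_le_iff) auto
    then have "real (card Y) \<le> C * (2 * r) powr \<alpha> / (inverse C * (\<delta> / 3) powr \<alpha>)"
      using C that by (subst pos_le_divide_eq) auto
    also have "\<dots> = C\<^sup>2 * ((2 * r) / (\<delta> / 3)) powr \<alpha>"
      using C that by (subst powr_divide) (auto simp: field_simps power2_eq_square)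
    also have "2 * r / (\<delta> / 3) = 6 * (r / \<delta>)" by simp
    also have "C\<^sup>2 * (6 * (r / \<delta>)) powr \<alpha> = A * (r / \<delta>) powr \<alpha>"
      using that by (subst powr_mult) (auto simp: A_def)
    finally show ?thesis .
  qed

  have "regular_piece S \<alpha> A c"
  proof
    show "compact S" using \<open>closed E\<close> by (simp add: S_def closed_Int_compact)
    show "S \<noteq> {}" using E \<rho> by (auto simp: S_def intro!: exI[of _ x0])
    show "0 < \<alpha>" "1 \<le> A" "0 < c" by fact+
  next
    fix x \<delta> r Y
    assume *: "x \<in> S" "0 < \<delta>" "\<delta> \<le> r" "finite Y" "Y \<subseteq> S \<inter> cball x r" "separated \<delta> Y"
    show "real (card Y) \<le> A * (r / \<delta>) powr \<alpha>"
    \<comment> \<open>Since \<open>S\<close> has diameter at most \<open>2 * \<rho>\<close>, a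
      larger r can be cut down to this value, and for larger \<open>\<delta>\<close> the set
      \<open>Y\<close> has at most one point.\<close>
    proof (cases "\<delta> \<le> 2 * \<rho>")
      case True
      have "real (card Y) \<le> A * (min r (2 * \<rho>) / \<delta>) powr \<alpha>"
        using * True \<rho> diamS[of x] subsetD[OF *(5)] by (intro upper0[of x]) (auto simp: S_def)
      also have "\<dots> \<le> A * (r / \<delta>) powr \<alpha>"
        using * True A1 \<alpha> \<rho> by (intro mult_left_mono powr_mono2 divide_right_mono) auto
      finally show ?thesis .
    next
      case False
      have "y = z" if "y \<in> Y" "z \<in> Y" for y z
      proof (rule ccontr)
        assume "y \<noteq> z"
        then have "\<delta> \<le> dist y z" using *(6) that unfolding separated_def by blast
        moreover have "y \<in> S" "z \<in> S" using *(5) that by auto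
        ultimately show False using diamS[of y z] False by linarith
      qed
      then have "card Y \<le> 1" using card_le_Suc0_iff_eq[OF *(4)] by simp
      moreover have "1 * 1 \<le> A * (r / \<delta>) powr \<alpha>"
        using A1 * \<alpha> by (intro mult_mono ge_one_powr_ge_zero) auto
      ultimately show ?thesis by linarith
    qed
  next
    fix \<delta> X assume *: "0 < \<delta>" "finite X" "X \<subseteq> S" "S \<subseteq> (\<Union>x\<in>X. cball x \<delta>)"
    show "c * \<delta> powr (-\<alpha>) \<le> real (card X)"
    proof (cases "2 * \<delta> < R")
      case True
      have "ennreal (inverse C * \<rho> powr \<alpha>) \<le> hausdorff_measure \<alpha> (E \<inter> ball x0 \<rho>)"
        using E \<rho> by (intro lo) (auto simp: \<rho>_def)
      also have "\<dots> \<le> hausdorff_measure \<alpha> (\<Union>x\<in>X. E \<inter> ball x (2 * \<delta>))"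
      proof (intro hausdorff_measure_mono subsetI)
        fix z assume z: "z \<in> E \<inter> ball x0 \<rho>"
        then have "z \<in> S" by (auto simp: S_def)
        then obtain x where "x \<in> X" "dist x z \<le> \<delta>" using *(4) by auto
        then show "z \<in> (\<Union>x\<in>X. E \<inter> ball x (2 * \<delta>))" using z *(1) by (intro UN_I[of x]) auto
      qed
      also have "\<dots> \<le> (\<Sum>x\<in>X. hausdorff_measure \<alpha> (E \<inter> ball x (2 * \<delta>)))"
        by (rule hausdorff_measure_UN_finite[OF *(2)])
      also have "\<dots> \<le> (\<Sum>x\<in>X. ennreal (C * (2 * \<delta>) powr \<alpha>))"
        using * True by (intro sum_mono up) (auto simp: S_def)
      also have "\<dots> = ennreal (real (card X) * (C * (2 * \<delta>) powr \<alpha>))"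
        using C by (simp add: ennreal_mult' ennreal_of_nat_eq_real_of_nat)
      finally have "inverse C * \<rho> powr \<alpha> \<le> real (card X) * (C * (2 * \<delta>) powr \<alpha>)"
        using C by (subst (asm) ennreal_le_iff) auto
      moreover have "c * \<delta> powr (-\<alpha>) = inverse C * \<rho> powr \<alpha> / (C * (2 * \<delta>) powr \<alpha>)"
        using C \<rho> * by (simp add: c_def powr_divide powr_mult powr_minus field_simps power2_eq_square)
      ultimately show ?thesis
        using C * by (simp add: pos_divide_le_eq)
    next
      \<comment> \<open>At these large scales the left side is at most 1, while \<open>X\<close> is
        nonempty.\<close>
      case False
      have "\<rho> / (2 * \<delta>) \<le> 1" using False * \<rho> by (simp add: \<rho>_def)
      have "inverse (C\<^sup>2) * (\<rho> / (2 * \<delta>)) powr \<alpha> \<le> 1 * 1 powr \<alpha>"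
        using C \<rho> * \<alpha> \<open>\<rho> / (2 * \<delta>) \<le> 1\<close> by (intro mult_mono powr_mono2) (auto simp: inverse_le_1_iff)
      moreover have "c * \<delta> powr (-\<alpha>) = inverse (C\<^sup>2) * (\<rho> / (2 * \<delta>)) powr \<alpha>"
        using \<rho> * by (simp add: c_def powr_divide powr_mult powr_minus field_simps)
      moreover have "X \<noteq> {}" using * E \<rho> by (auto simp: S_def)
      then have "1 \<le> card X" using * by (simp add: Suc_le_eq card_gt_0_iff)
      ultimately show ?thesis by simp
    qed
  qed
  then show thesis using that[of S A c] by (auto simp: S_def)
qed

section \<open>Upper bound for the dimension of AD-regular sets\<close>

lemma hausdorff_measure_subsingleton:
  fixes E :: "'a::metric_space set"
  assumes "\<And>x y. x \<in> E \<Longrightarrow> y \<in> E \<Longrightarrow> x = y" "0 < t"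
  shows "hausdorff_measure t E = 0"
proof -
  have E: "E = {} \<or> (\<exists>x. E = {x})" using assms(1) by blast
  show ?thesis
    using E assms(2) by (intro hausdorff_measure_null_finite_covers exI[of _ 0] exI[of _ "{E}"]) auto
qed

text \<open>Balls of radius R/2 centred in \<open>E\<close> have finite
  \<open>\<alpha>\<close>-dimensional measure, and countably many of them, centred in a dense
  subset, cover \<open>E\<close>.\<close>

lemma AD_regular_with_dim_le:
  fixes E :: "'a::euclidean_space set"
  assumes AD: "AD_regular_with \<alpha> C E"
  shows "hausdorff_dim E \<le> ennreal \<alpha>"
proof (rule hausdorff_dim_le)
  show "0 \<le> \<alpha>" using AD by (simp add: AD_regular_with_def)
  fix t assume t: "\<alpha> < t"
  show "hausdorff_measure t E = 0"
  proof (cases "\<exists>x0\<in>E. \<exists>x1\<in>E. x0 \<noteq> x1")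
    case True
    then obtain R where R: "0 < R"
      and up: "\<And>x r. x \<in> E \<Longrightarrow> 0 < r \<Longrightarrow> r < R \<Longrightarrow> hausdorff_measure \<alpha> (E \<inter> ball x r) \<le> ennreal (C * r powr \<alpha>)"
      using AD_regular_withE[OF AD] by metis
    obtain T where T: "countable T" "T \<subseteq> E" "E \<subseteq> closure T"
      using separable[of E] by blast
    have null: "hausdorff_measure t (E \<inter> ball x (R / 2)) = 0" if "x \<in> E" for x
    proof (rule hausdorff_measure_null_of_finite[OF \<open>0 \<le> \<alpha>\<close> t])
      show "hausdorff_measure \<alpha> (E \<inter> ball x (R / 2)) < top"
        using up[OF that, of "R / 2"] R by (auto intro: order.strict_trans1 simp: ennreal_less_top)
    qed
    have "E \<subseteq> (\<Union>x\<in>T. E \<inter> ball x (R / 2))"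
    proof
      fix x assume "x \<in> E"
      then obtain y where "y \<in> T" "dist y x < R / 2"
        using T(3) R closure_approachable[of x T] by (meson half_gt_zero subsetD)
      then show "x \<in> (\<Union>x\<in>T. E \<inter> ball x (R / 2))" using \<open>x \<in> E\<close> by auto
    qed
    moreover have "hausdorff_measure t (\<Union>x\<in>T. E \<inter> ball x (R / 2)) = 0"
      using T null by (intro hausdorff_measure_UN_null) auto
    ultimately show ?thesis by (metis hausdorff_measure_mono le_zero_eq)
  next
    case False
    then show ?thesis using \<open>0 \<le> \<alpha>\<close> t by (intro hausdorff_measure_subsingleton) auto
  qed
qed

section \<open>Grids of directions\<close>

definition dir :: "real \<Rightarrow> real^2" where
  "dir \<theta> = vector [cos \<theta>, sin \<theta>]"

lemma dir_inner: "dir \<theta> \<bullet> u = cos \<theta> * u $ 1 + sin \<theta> * u $ 2"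
  by (simp add: dir_def inner_vec_def sum_2)

lemma norm_vec2: "norm (u :: real^2) = sqrt ((u $ 1)\<^sup>2 + (u $ 2)\<^sup>2)"
  by (simp add: norm_vec_def L2_set_def sum_2)

lemma norm_dir [simp]: "norm (dir \<theta>) = 1"
  by (simp add: norm_vec2 dir_def)

text \<open>The squared chord is four times the squared sine of half the angle, and |sin x| is at
  most |x|.\<close>

lemma norm_dir_diff_le: "norm (dir \<theta> - dir \<tau>) \<le> \<bar>\<theta> - \<tau>\<bar>"
proof -
  have "(norm (dir \<theta> - dir \<tau>))\<^sup>2 = (cos \<theta> - cos \<tau>)\<^sup>2 + (sin \<theta> - sin \<tau>)\<^sup>2"
    by (simp add: norm_vec2 dir_def)
  also have "\<dots> = (cos \<theta>)\<^sup>2 + (sin \<theta>)\<^sup>2 + ((cos \<tau>)\<^sup>2 + (sin \<tau>)\<^sup>2) - 2 * cos (\<theta> - \<tau>)"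
    unfolding cos_diff by (simp add: power2_eq_square algebra_simps)
  also have "\<dots> = 2 - 2 * cos (2 * ((\<theta> - \<tau>) / 2))" by (simp only: mult_2 field_sum_of_halves sin_cos_squared_add2)
  also have "\<dots> = 4 * (sin ((\<theta> - \<tau>) / 2))\<^sup>2" unfolding cos_double_sin by simp
  also have "\<dots> \<le> 4 * ((\<theta> - \<tau>) / 2)\<^sup>2"
    by (intro mult_left_mono abs_le_square_iff[THEN iffD1] abs_sin_x_le_abs_x) simp
  also have "\<dots> = \<bar>\<theta> - \<tau>\<bar>\<^sup>2" by (simp add: power_divide)
  finally show ?thesis by (rule power2_le_imp_le) simp
qed

lemma abs_dir_inner_diff_le: "\<bar>dir \<theta> \<bullet> u - dir \<tau> \<bullet> u\<bar> \<le> \<bar>\<theta> - \<tau>\<bar> * norm u"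
proof -
  have "\<bar>dir \<theta> \<bullet> u - dir \<tau> \<bullet> u\<bar> \<le> norm (dir \<theta> - dir \<tau>) * norm u"
    unfolding inner_diff_left[symmetric] by (rule Cauchy_Schwarz_ineq2)
  also have "\<dots> \<le> \<bar>\<theta> - \<tau>\<bar> * norm u"
    by (intro mult_right_mono norm_dir_diff_le) simp
  finally show ?thesis .
qed

lemma half_le_sin: "0 \<le> t \<Longrightarrow> t \<le> 1 \<Longrightarrow> t / 2 \<le> sin (t::real)"
proof -
  assume t: "0 \<le> t" "t \<le> 1"
  have "sin 0 - 0 / 2 \<le> sin t - t / 2"
  proof (rule DERIV_nonneg_imp_nondecreasing[OF t(1)])
    fix s assume s: "0 \<le> s" "s \<le> t"
    \<comment> \<open>As s is at most 1 and so below pi/3, the derivative of sin s - s/2 is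
      nonnegative.\<close>
    have "cos (pi / 3) \<le> cos s"
      using s t pi_gt3 by (intro cos_monotone_0_pi_le) auto
    then have "0 \<le> cos s - 1 / 2" by (simp add: cos_60)
    moreover have "((\<lambda>s. sin s - s / 2) has_real_derivative cos s - 1 / 2) (at s)"
      by (auto intro!: derivative_eq_intros)
    ultimately show "\<exists>y. ((\<lambda>s. sin s - s / 2) has_real_derivative y) (at s) \<and> 0 \<le> y" by blast
  qed
  then show ?thesis by simp
qed

lemma half_abs_le_abs_sin: "\<bar>t\<bar> \<le> 1 \<Longrightarrow> \<bar>t\<bar> / 2 \<le> \<bar>sin (t::real)\<bar>"
  using half_le_sin[of t] half_le_sin[of "-t"] by (cases "0 \<le> t") auto

text \<open>Cramer's rule recovers \<open>u\<close> from its inner products with the two directions,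
  the determinant being up to sign the sine of the angle between them; if both products are small,
  so is this sine. The bound 1 on the difference excludes antipodal directions.\<close>

lemma dir_inner_small_imp_close:
  assumes "\<bar>dir \<theta> \<bullet> u\<bar> \<le> \<eta> * norm u" "\<bar>dir \<tau> \<bullet> u\<bar> \<le> \<eta> * norm u" "u \<noteq> 0" "\<bar>\<theta> - \<tau>\<bar> \<le> 1"
  shows "\<bar>\<theta> - \<tau>\<bar> \<le> 4 * \<eta>"
proof -
  define p q where "p = dir \<theta> \<bullet> u" and "q = dir \<tau> \<bullet> u"
  have "sin (\<theta> - \<tau>) *\<^sub>R u = q *\<^sub>R vector [sin \<theta>, - cos \<theta>] - p *\<^sub>R vector [sin \<tau>, - cos \<tau>]"
    by (simp add: vec_eq_iff forall_2 p_def q_def dir_inner sin_diff algebra_simps)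
  then have "\<bar>sin (\<theta> - \<tau>)\<bar> * norm u = norm (q *\<^sub>R vector [sin \<theta>, - cos \<theta>] - p *\<^sub>R vector [sin \<tau>, - cos \<tau>] :: real^2)"
    by (metis norm_scaleR)
  also have "\<dots> \<le> \<bar>q\<bar> + \<bar>p\<bar>"
  proof -
    have "norm (vector [sin t, - cos t] :: real^2) = 1" for t :: real by (simp add: norm_vec2)
    then show ?thesis using norm_triangle_ineq4[of "q *\<^sub>R vector [sin \<theta>, - cos \<theta>]"] by (metis norm_scaleR mult_1_right)
  qed
  also have "\<dots> \<le> 2 * \<eta> * norm u" using assms(1,2) by (simp add: p_def q_def)
  finally have "\<bar>sin (\<theta> - \<tau>)\<bar> \<le> 2 * \<eta>" using assms(3) by simp
  from order_trans[OF half_abs_le_abs_sin[OF assms(4)] this] show ?thesis by simp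
qed

text \<open>By \<open>dir_inner_small_imp_close\<close>, all angles counted lie within
  \<open>4 * \<eta>\<close> of the smallest one; the term 1 counts that one.\<close>

lemma card_grid_dir_small_le:
  assumes "0 < h" "real J * h \<le> 1" "u \<noteq> 0" "0 \<le> \<eta>"
  shows "real (card {j\<in>{..<J}. \<bar>dir (\<theta> + real j * h) \<bullet> u\<bar> \<le> \<eta> * norm u}) \<le> 4 * \<eta> / h + 1"
    (is "real (card ?T) \<le> _")
proof (cases "?T = {}")
  case False
  have fin: "finite ?T" by simp
  define j0 where "j0 = Min ?T"
  have j0: "j0 \<in> ?T" using Min_in[OF fin False] by (simp add: j0_def)
  have "?T \<subseteq> {j0..j0 + nat \<lfloor>4 * \<eta> / h\<rfloor>}"
  proof
    fix j assume j: "j \<in> ?T"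
    then have le: "j0 \<le> j" using fin by (simp add: j0_def)
    have "(real j - real j0) * h \<le> real J * h"
      using j assms(1) by (intro mult_right_mono) auto
    then have "\<bar>(\<theta> + real j * h) - (\<theta> + real j0 * h)\<bar> \<le> 1"
      using le assms(1,2) by (simp add: left_diff_distrib abs_if)
    then have "\<bar>(\<theta> + real j * h) - (\<theta> + real j0 * h)\<bar> \<le> 4 * \<eta>"
      using j j0 assms(3) by (intro dir_inner_small_imp_close[of _ u]) auto
    then have "(real j - real j0) * h \<le> 4 * \<eta>" by (simp add: algebra_simps)
    then have "real (j - j0) \<le> 4 * \<eta> / h"
      using assms(1) le by (simp add: pos_le_divide_eq of_nat_diff)
    then have "j - j0 \<le> nat \<lfloor>4 * \<eta> / h\<rfloor>" by (rule le_nat_floor)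
    then show "j \<in> {j0..j0 + nat \<lfloor>4 * \<eta> / h\<rfloor>}" using le by auto
  qed
  then have "card ?T \<le> card {j0..j0 + nat \<lfloor>4 * \<eta> / h\<rfloor>}" by (rule card_mono[rotated]) simp
  then have "real (card ?T) \<le> real (nat \<lfloor>4 * \<eta> / h\<rfloor>) + 1" by simp
  also have "\<dots> \<le> 4 * \<eta> / h + 1" using assms by simp
  finally show ?thesis .
next
  case True
  show ?thesis unfolding True using assms by simp
qed

section \<open>Counting grid directions that hit net points\<close>

lemma card_swap:
  assumes "finite A" "finite B"
  shows "(\<Sum>a\<in>A. card {b\<in>B. P a b}) = (\<Sum>b\<in>B. card {a\<in>A. P a b})"
proof -
  have "(\<Sum>a\<in>A. card {b\<in>B. P a b}) = (\<Sum>a\<in>A. \<Sum>b\<in>B. if P a b then 1 else 0)"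
    using assms by (intro sum.cong) (auto simp: sum.If_cases Int_def conj_commute)
  also have "\<dots> = (\<Sum>b\<in>B. \<Sum>a\<in>A. if P a b then 1 else 0)" by (rule sum.swap)
  also have "\<dots> = (\<Sum>b\<in>B. card {a\<in>A. P a b})"
    using assms by (intro sum.cong) (auto simp: sum.If_cases Int_def conj_commute)
  finally show ?thesis .
qed

lemma sum_UN_le:
  fixes f :: "'a \<Rightarrow> real"
  assumes "finite I" "\<And>i. finite (A i)" "\<And>x. 0 \<le> f x"
  shows "sum f (\<Union>i\<in>I. A i) \<le> (\<Sum>i\<in>I. sum f (A i))"
  using assms(1)
proof (induction I rule: finite_induct)
  case (insert i I)
  have "sum f (A i \<union> (\<Union>i\<in>I. A i)) \<le> sum f (A i) + sum f (\<Union>i\<in>I. A i)"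
    using insert.hyps assms by (subst sum_Un) (auto intro: sum_nonneg)
  with insert show ?case by simp
qed simp

locale plane_piece = regular_piece S \<alpha> A c for S :: "(real^2) set" and \<alpha> A c
begin

text \<open>The dimension expected of a fibre: \<open>\<alpha> - \<beta>\<close> is the minimum of
  \<open>\<alpha>\<close> and 1, the dimension expected of the projection.\<close>

definition "\<beta> = max (\<alpha> - 1) 0"

text \<open>Dyadic shells around \<open>x\<close>: a net point at distance about \<open>2\<^sup>i \<delta>\<close> is hit by a proportion of
  about \<open>2\<^sup>-\<^sup>i\<close> of the directions, and there are at most \<open>A 2\<^sup>i\<^sup>\<alpha>\<close> such points.\<close>
lemma sum_card_grid_dir_small_le:
  fixes b J :: nat
  assumes x: "x \<in> S" and \<delta>: "0 < \<delta>" and J: "J \<le> 2 ^ b"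
    and Y: "finite Y" "Y \<subseteq> S" "separated \<delta> Y" "\<And>y. y \<in> Y \<Longrightarrow> dist x y \<le> 4 * 2 ^ b * \<delta>"
  shows "(\<Sum>y\<in>Y. real (card {j\<in>{..<J}. \<bar>dir (\<theta> + real j * (1/2) ^ b) \<bullet> (x - y)\<bar> \<le> 8 * \<delta>}))
    \<le> (real b + 3) * (A * 2 ^ (7 + b) * 2 powr ((real b + 2) * \<beta>))"
    (is "(\<Sum>y\<in>Y. real (?n y)) \<le> _")
proof -
  define sh where "sh i = {y\<in>Y. dist x y \<le> 2 ^ i * \<delta> \<and> (i = 0 \<or> 2 ^ (i - 1) * \<delta> < dist x y)}" for i
  have sub: "Y \<subseteq> (\<Union>i\<in>{..b + 2}. sh i)"
  proof
    fix y assume y: "y \<in> Y"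
    define i where "i = (LEAST i. dist x y \<le> 2 ^ i * \<delta>)"
    have "dist x y \<le> 2 ^ (b + 2) * \<delta>" using Y(4)[OF y] by (simp add: power_add mult_ac)
    then have "dist x y \<le> 2 ^ i * \<delta>" "i \<le> b + 2"
      unfolding i_def by (rule LeastI) (rule Least_le, fact)
    moreover have "i = 0 \<or> 2 ^ (i - 1) * \<delta> < dist x y"
      using not_less_Least[of "i - 1" "\<lambda>i. dist x y \<le> 2 ^ i * \<delta>"] unfolding i_def[symmetric]
      by (cases i) auto
    ultimately show "y \<in> (\<Union>i\<in>{..b + 2}. sh i)" using y by (auto simp: sh_def)
  qed
  have card_sh: "real (card (sh i)) \<le> A * 2 powr (real i * \<alpha>)" for i
  proof -
    have "real (card (sh i)) \<le> A * ((2 ^ i * \<delta>) / \<delta>) powr \<alpha>"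
      using Y \<delta> x by (intro upper[of x]) (auto simp: sh_def separated_def)
    also have "((2 ^ i * \<delta>) / \<delta>) powr \<alpha> = 2 powr (real i * \<alpha>)"
      using \<delta> by (simp add: powr_powr flip: powr_realpow)
    finally show ?thesis .
  qed
  have n_le: "real (?n y) \<le> 2 ^ (7 + b) / 2 ^ i" if y: "y \<in> sh i" and i: "i \<le> b + 2" for i y
  proof (cases "i = 0")
    case True
    have "?n y \<le> card {..<J}" by (intro card_mono) auto
    then have "?n y \<le> 2 ^ b" using J by simp
    then have "real (?n y) \<le> 2 ^ b" by (simp flip: of_nat_le_iff)
    also have "(2::real) ^ b \<le> 2 ^ (7 + b)" by (intro power_increasing) auto
    finally show ?thesis using True by simp
  next
    case False
    define u where "u = x - y"
    have nu: "2 ^ (i - 1) * \<delta> < norm u" using y False by (auto simp: sh_def u_def dist_norm)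
    have u0: "u \<noteq> 0" using nu \<delta> by (auto simp: mult_less_0_iff)
    define \<eta> where "\<eta> = 8 * \<delta> / norm u"
    have "\<eta> \<le> 8 * \<delta> / (2 ^ (i - 1) * \<delta>)"
      unfolding \<eta>_def using nu \<delta> u0 by (intro divide_left_mono) auto
    also have "\<dots> = 16 / 2 ^ i" using False \<delta> by (cases i) auto
    finally have \<eta>: "\<eta> \<le> 16 / 2 ^ i" .
    have "real J * (1/2) ^ b \<le> 2 ^ b * (1/2) ^ b"
      using J by (intro mult_right_mono) (simp_all flip: of_nat_le_iff)
    also have "\<dots> = 1" by (simp flip: power_mult_distrib)
    finally have Jb: "real J * (1/2) ^ b \<le> 1" .
    have "{j\<in>{..<J}. \<bar>dir (\<theta> + real j * (1/2) ^ b) \<bullet> (x - y)\<bar> \<le> 8 * \<delta>}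
        = {j\<in>{..<J}. \<bar>dir (\<theta> + real j * (1/2) ^ b) \<bullet> u\<bar> \<le> \<eta> * norm u}"
      using u0 by (simp add: \<eta>_def u_def)
    then have "real (?n y) \<le> 4 * \<eta> / (1/2) ^ b + 1"
      using card_grid_dir_small_le[OF _ Jb u0, of \<eta> \<theta>] \<delta> by (simp add: \<eta>_def)
    also have "\<dots> = 4 * \<eta> * 2 ^ b + 1" by (simp add: power_divide)
    also have "\<dots> \<le> 4 * (16 / 2 ^ i) * 2 ^ b + 1"
      using \<eta> by (intro add_right_mono mult_right_mono mult_left_mono) auto
    \<comment> \<open>The additive 1 is absorbed because the last shell has index b + 2.\<close>
    also have "\<dots> \<le> 4 * (16 / 2 ^ i) * 2 ^ b + 2 ^ (b + 2) / 2 ^ i"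
    proof -
      have "(2::real) ^ i \<le> 2 ^ (b + 2)" using i by (intro power_increasing) auto
      then have "1 \<le> (2::real) ^ (b + 2) / 2 ^ i" by (subst pos_le_divide_eq) auto
      then show ?thesis by (rule add_left_mono)
    qed
    also have "\<dots> = (64 + 4) * (2 ^ b / 2 ^ i)" by (simp add: power_add)
    also have "\<dots> \<le> 128 * (2 ^ b / 2 ^ i)" by (intro mult_right_mono) auto
    also have "\<dots> = 2 ^ (7 + b) / 2 ^ i" by (simp add: power_add)
    finally show ?thesis .
  qed
  have "(\<Sum>y\<in>Y. real (?n y)) \<le> (\<Sum>y\<in>(\<Union>i\<in>{..b + 2}. sh i). real (?n y))"
    using Y sub by (intro sum_mono2) (auto simp: sh_def)
  also have "\<dots> \<le> (\<Sum>i\<le>b + 2. \<Sum>y\<in>sh i. real (?n y))"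
    using Y(1) by (intro sum_UN_le) (auto simp: sh_def)
  also have "\<dots> \<le> (\<Sum>i\<le>b + 2. A * 2 ^ (7 + b) * 2 powr ((real b + 2) * \<beta>))"
  proof (intro sum_mono)
    fix i assume "i \<in> {..b + 2}"
    then have i: "i \<le> b + 2" by simp
    have "(\<Sum>y\<in>sh i. real (?n y)) \<le> real (card (sh i)) * (2 ^ (7 + b) / 2 ^ i)"
      using n_le[OF _ i] by (rule sum_bounded_above)
    also have "\<dots> \<le> (A * 2 powr (real i * \<alpha>)) * (2 ^ (7 + b) / 2 ^ i)"
      by (intro mult_right_mono card_sh) simp
    also have "\<dots> = A * 2 ^ (7 + b) * 2 powr (real i * (\<alpha> - 1))"
      by (simp add: right_diff_distrib powr_diff powr_realpow)
    also have "\<dots> \<le> A * 2 ^ (7 + b) * 2 powr ((real b + 2) * \<beta>)"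
    proof -
      have "real i * (\<alpha> - 1) \<le> real i * \<beta>" by (intro mult_left_mono) (auto simp: \<beta>_def)
      also have "\<dots> \<le> (real b + 2) * \<beta>" using i by (intro mult_right_mono) (auto simp: \<beta>_def)
      finally show ?thesis using pos by (intro mult_left_mono powr_mono) auto
    qed
    finally show "(\<Sum>y\<in>sh i. real (?n y)) \<le> A * 2 ^ (7 + b) * 2 powr ((real b + 2) * \<beta>)" .
  qed
  finally show ?thesis by (simp add: add.commute)
qed

text \<open>Markov's inequality: the total number of hits over all angles becomes, after exchanging
  the order of summation, the sum just bounded.\<close>

lemma card_bad_grid_dir_le:
  fixes b J :: nat
  assumes x: "x \<in> S" and \<delta>: "0 < \<delta>" and J: "J \<le> 2 ^ b" and M: "0 < M"
    and Y: "finite Y" "Y \<subseteq> S" "separated \<delta> Y"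
  shows "real (card {j\<in>{..<J}. M < real (card {y\<in>Y. dist x y \<le> 4 * 2 ^ b * \<delta> \<and>
              \<bar>dir (\<theta> + real j * (1/2) ^ b) \<bullet> (x - y)\<bar> \<le> 8 * \<delta>})})
    \<le> (real b + 3) * (A * 2 ^ (7 + b) * 2 powr ((real b + 2) * \<beta>)) / M"
proof -
  define Y' where "Y' = {y\<in>Y. dist x y \<le> 4 * 2 ^ b * \<delta>}"
  define P where "P j y \<longleftrightarrow> \<bar>dir (\<theta> + real j * (1/2) ^ b) \<bullet> (x - y)\<bar> \<le> 8 * \<delta>" for j :: nat and y
  define B where "B = {j\<in>{..<J}. M < real (card {y\<in>Y'. P j y})}"
  have fin: "finite Y'" using Y by (simp add: Y'_def)
  have "real (card B) * M \<le> (\<Sum>j\<in>B. real (card {y\<in>Y'. P j y}))"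
    using sum_mono[of B "\<lambda>_. M" "\<lambda>j. real (card {y\<in>Y'. P j y})"] by (simp add: B_def)
  also have "\<dots> \<le> (\<Sum>j<J. real (card {y\<in>Y'. P j y}))"
    by (intro sum_mono2) (auto simp: B_def)
  also have "\<dots> = (\<Sum>y\<in>Y'. real (card {j\<in>{..<J}. P j y}))"
    using card_swap[of "{..<J}" Y' P] fin by (simp flip: of_nat_sum)
  also have "\<dots> \<le> (real b + 3) * (A * 2 ^ (7 + b) * 2 powr ((real b + 2) * \<beta>))"
    unfolding P_def using Y by (intro sum_card_grid_dir_small_le[OF x \<delta> J fin]) (auto simp: Y'_def separated_def)
  finally show ?thesis
    using M by (simp add: pos_le_divide_eq B_def Y'_def P_def conj_assoc)
qed

end

section \<open>The set of directions\<close>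

text \<open>\<open>blk k\<close> and \<open>gap k\<close> are the exponents \<open>b\<^sub>k\<close> and \<open>a\<^sub>k\<close> of the introduction.\<close>
definition blk :: "nat \<Rightarrow> nat" where "blk k = (fact k)\<^sup>2"

lemma two_power_mult_half_power: "(2::real) ^ n * (1/2) ^ (n + m) = (1/2) ^ m"
  by (simp add: power_add power_divide)

definition gap :: "nat \<Rightarrow> nat" where "gap k = k * blk (k - 1)"

lemma blk_Suc: "blk (Suc k) = (Suc k)\<^sup>2 * blk k"
  by (simp only: blk_def fact_Suc power_mult_distrib of_nat_id)

lemma gap_Suc: "gap (Suc k) = Suc k * blk k"
  by (simp add: gap_def)

lemma blk_eq_gap: "0 < k \<Longrightarrow> blk k = k * gap k"
  by (cases k) (simp_all add: blk_Suc gap_Suc power2_eq_square algebra_simps)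

lemma blk_pos: "0 < blk k"
  by (simp add: blk_def)

lemma le_gap: "k \<le> gap k"
  by (simp add: gap_def blk_def)

lemma gap_less_blk: "2 \<le> k \<Longrightarrow> gap k < blk k"
  using le_gap[of k] by (simp add: blk_eq_gap)

lemma blk_le_gap_Suc: "blk k \<le> gap (Suc k)"
  by (simp add: gap_Suc)

lemma gap_mono_Suc: "gap k < gap (Suc k)"
proof (cases k)
  case (Suc n)
  have "gap k \<le> blk k" by (simp add: Suc blk_eq_gap)
  also have "\<dots> < Suc k * blk k" using blk_pos[of k] Suc by simp
  finally show ?thesis by (simp only: gap_Suc)
qed (simp add: gap_def blk_def)

text \<open>The windows lie to the right of the grid points because the angles constructed below
  increase to their limit. One radian of directions is enough.\<close>

definition Theta :: "real set" where
  "Theta = {\<theta>\<in>{0..1}. \<forall>k. \<exists>i::nat. real i * (1/2) ^ blk k \<le> \<theta> \<and> \<theta> \<le> real i * (1/2) ^ blk k + (1/2) ^ gap (Suc k)}"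

text \<open>Angles at most 1 need only grid indices up to \<open>2 ^ blk k\<close>, so each union is
  finite. This makes \<open>Theta\<close> closed and yields its economical covers.\<close>

lemma Theta_eq:
  "Theta = {0..1} \<inter> (\<Inter>k. \<Union>i\<in>{..2 ^ blk k}. {real i * (1/2) ^ blk k..real i * (1/2) ^ blk k + (1/2) ^ gap (Suc k)})"
proof -
  have "i \<le> 2 ^ n" if "real i * (1/2) ^ n \<le> \<theta>" "\<theta> \<le> 1" for i n \<theta>
  proof -
    have "real i * (1/2) ^ n \<le> 1" using that by linarith
    then have "real i \<le> 2 ^ n" by (simp add: power_divide)
    then show ?thesis by (simp flip: of_nat_le_iff)
  qed
  then show ?thesis unfolding Theta_def by fastforce
qed

lemma compact_Theta: "compact Theta"
  unfolding Theta_eq by (intro compact_Int_closed compact_Icc closed_INT ballI closed_UN) auto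

section \<open>Good and bad angles at the points of a net\<close>

locale plane_net = plane_piece S \<alpha> A c for S \<alpha> A c +
  fixes Y :: "nat \<Rightarrow> (real^2) set"
  assumes net: "finite (Y n)" "Y n \<subseteq> S" "separated ((1/2) ^ n) (Y n)"
    and net_near: "x \<in> S \<Longrightarrow> \<exists>y\<in>Y n. dist x y < (1/2) ^ n"
begin

text \<open>The factor \<open>q\<close> is 8 for the grid angle and 4 for the limit angle, whose error it absorbs.\<close>
definition hits :: "real \<Rightarrow> nat \<Rightarrow> nat \<Rightarrow> real \<Rightarrow> real^2 \<Rightarrow> (real^2) set" where
  "hits q k m \<theta> x = {y\<in>Y (Suc m * blk k). dist x y \<le> 4 * (1/2) ^ (m * blk k) \<and>
     \<bar>dir \<theta> \<bullet> (x - y)\<bar> \<le> q * (1/2) ^ (Suc m * blk k)}"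

text \<open>Since \<open>gap k = blk k / k\<close>, this is \<open>2 powr (blk k * (\<beta> + 2/k))\<close>: the fibre bound \<open>2 powr (blk k * \<beta>)\<close>
  expected from Marstrand's theorem, with a margin that makes \<open>bad\<close> improbable.\<close>
definition "M k = 2 powr (real (blk k) * \<beta> + 2 * real (gap k))"

definition "good k \<tau> x \<longleftrightarrow> (\<forall>m\<in>{k..<(k+1)^3}. real (card (hits 4 k m \<tau> x)) \<le> M k)"

definition "bad k \<theta> x \<longleftrightarrow> (\<exists>m\<in>{k..<(k+1)^3}. M k < real (card (hits 8 k m \<theta> x)))"

text \<open>A bound for the proportion of candidate angles in \<open>card_bad_le\<close> that are
  bad at a given point. Its factors are the number of levels m, the number of dyadic shells, the
  saving 2^(-\<open>gap k\<close>), and constants.\<close>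

definition "p k = (real k + 1) ^ 3 * (real (blk k) + 3) * 2 powr (- real (gap k)) * (A * 2 powr (8 + 2 * \<beta>))"

lemma finite_hits [simp]: "finite (hits q k m \<theta> x)"
  using net(1) by (simp add: hits_def)

text \<open>The candidates are consecutive points of the grid of mesh 2^(-\<open>blk k\<close>) and
  fill half a window of length 2^(-\<open>gap k\<close>). Each level m contributes at most the
  Markov bound \<open>D\<close>.\<close>

lemma card_bad_le:
  assumes k: "2 \<le> k" and x: "x \<in> S"
  shows "real (card {j\<in>{..<2 ^ (blk k - gap k - 1)}. bad k (\<theta> + real j * (1/2) ^ blk k) x})
    \<le> p k * 2 ^ (blk k - gap k - 1)"
proof -
  let ?J = "2 ^ (blk k - gap k - 1) :: nat"
  define B where "B m = {j\<in>{..<?J}. M k < real (card (hits 8 k m (\<theta> + real j * (1/2) ^ blk k) x))}" for m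
  define D where "D = (real (blk k) + 3) * (A * 2 ^ (7 + blk k) * 2 powr ((real (blk k) + 2) * \<beta>)) / M k"
  have D0: "0 \<le> D" using pos by (simp add: D_def M_def)
  have "real (card (B m)) \<le> D" for m
  proof -
    have "(2::real) ^ blk k * (1/2) ^ (Suc m * blk k) = (1/2) ^ (m * blk k)"
      by (simp add: power_add power_divide)
    then have eq: "4 * 2 ^ blk k * (1/2) ^ (Suc m * blk k) = 4 * (1/2::real) ^ (m * blk k)"
      by (simp only: mult.assoc)
    show ?thesis
      unfolding B_def D_def hits_def
      using card_bad_grid_dir_le[OF x, of "(1/2) ^ (Suc m * blk k)" ?J "blk k" "M k" "Y (Suc m * blk k)" \<theta>]
        net[of "Suc m * blk k"] unfolding eq by (simp add: M_def power_increasing)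
  qed
  then have "(\<Sum>m\<in>{k..<(k+1)^3}. real (card (B m))) \<le> real (card {k..<(k+1)^3}) * D"
    by (intro sum_bounded_above) auto
  also have "\<dots> \<le> (real k + 1) ^ 3 * D"
  proof (intro mult_right_mono D0)
    have "card {k..<(k+1)^3} \<le> (k+1)^3" by simp
    then have "real (card {k..<(k+1)^3}) \<le> real ((k+1)^3)" by (simp only: of_nat_le_iff)
    then show "real (card {k..<(k+1)^3}) \<le> (real k + 1) ^ 3" by (simp add: add.commute)
  qed
  finally have le: "(\<Sum>m\<in>{k..<(k+1)^3}. real (card (B m))) \<le> (real k + 1) ^ 3 * D" .
  have "{j\<in>{..<?J}. bad k (\<theta> + real j * (1/2) ^ blk k) x} = (\<Union>m\<in>{k..<(k+1)^3}. B m)"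
    by (auto simp: bad_def B_def)
  then have "card {j\<in>{..<?J}. bad k (\<theta> + real j * (1/2) ^ blk k) x} \<le> (\<Sum>m\<in>{k..<(k+1)^3}. card (B m))"
    by (simp only: card_UN_le finite_atLeastLessThan)
  then have "real (card {j\<in>{..<?J}. bad k (\<theta> + real j * (1/2) ^ blk k) x}) \<le> (\<Sum>m\<in>{k..<(k+1)^3}. real (card (B m)))"
    by (simp only: of_nat_le_iff flip: of_nat_sum)
  also note le
  \<comment> \<open>Of the margin 2^(2 * \<open>gap k\<close>) in \<open>M k\<close>, one factor
    2^(\<open>gap k\<close>) is lost because the candidates fill only a short window; the other one
    is the saving in \<open>p k\<close>.\<close>
  also have "(real k + 1) ^ 3 * D = p k * 2 ^ (blk k - gap k - 1)"
  proof -
    have "(2::real) ^ (blk k - gap k - 1) = 2 powr (real (blk k) - real (gap k) - 1)"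
      using gap_less_blk[OF k] by (simp add: of_nat_diff algebra_simps flip: powr_realpow)
    moreover have "(2::real) ^ (7 + blk k) = 2 powr (7 + real (blk k))"
      by (simp flip: powr_realpow)
    moreover have "2 powr (7 + real (blk k)) * 2 powr ((real (blk k) + 2) * \<beta>) / M k
        = 2 powr (- real (gap k)) * 2 powr (8 + 2 * \<beta>) * 2 powr (real (blk k) - real (gap k) - 1)"
      unfolding M_def powr_add[symmetric] powr_diff[symmetric] by (simp add: algebra_simps)
    ultimately show ?thesis
      by (simp add: D_def p_def mult_ac flip: times_divide_eq_right)
  qed
  finally show ?thesis .
qed

lemma p_nonneg: "0 \<le> p k"
  using pos by (simp add: p_def)

text \<open>In terms of a = \<open>gap k\<close>, which is at least k, the number k and
  \<open>blk k\<close> = k * a are at most polynomial; so 2^(-a) dominates and leaves a geometric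
  series.\<close>

lemma summable_p: "summable p"
proof -
  have "\<forall>\<^sub>F a in at_top. 32 * a ^ 5 * 2 powr (- a) \<le> (2::real) powr (- a / 2)"
    by real_asymp
  then obtain a0 :: real where a0: "\<And>a. a0 \<le> a \<Longrightarrow> 32 * a ^ 5 * 2 powr (- a) \<le> 2 powr (- a / 2)"
    by (auto simp: eventually_at_top_linorder)
  have "summable (\<lambda>k. (2 powr (-1/2)) ^ k :: real)"
    by (rule summable_geometric) (simp add: powr_less_one)
  then have "summable (\<lambda>k. (2 powr (-1/2)) ^ k * (A * 2 powr (8 + 2 * \<beta>)))"
    by (rule summable_mult2)
  then show ?thesis
  proof (rule summable_comparison_test_ev[rotated])
    show "\<forall>\<^sub>F k in sequentially. norm (p k) \<le> (2 powr (-1/2)) ^ k * (A * 2 powr (8 + 2 * \<beta>))"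
      using eventually_ge_at_top[of "max 1 (nat \<lceil>a0\<rceil>)"]
    proof eventually_elim
      case (elim k)
      define a where "a = real (gap k)"
      have k: "1 \<le> k" "a0 \<le> a" "real k \<le> a"
        using elim le_gap[of k] by (auto simp: a_def)
      have k3: "(real k + 1) ^ 3 \<le> (2 * a) ^ 3"
        using k by (intro power_mono) auto
      have "real (blk k) = real k * a"
        using k by (simp add: blk_eq_gap a_def)
      then have "real (blk k) + 3 \<le> a * a + 3 * (1 * 1)"
        using k by (auto intro!: mult_right_mono)
      also have "\<dots> \<le> a * a + 3 * (a * a)"
        using k by (intro add_left_mono mult_left_mono mult_mono) auto
      finally have "real (blk k) + 3 \<le> 4 * (a * a)" by simp
      with k3 have "(real k + 1) ^ 3 * (real (blk k) + 3) \<le> (2 * a) ^ 3 * (4 * (a * a))"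
        using k by (intro mult_mono) auto
      also have "\<dots> = 32 * a ^ 5" by (simp add: power_mult_distrib power_numeral_reduce)
      finally have "(real k + 1) ^ 3 * (real (blk k) + 3) * 2 powr (- a) \<le> 32 * a ^ 5 * 2 powr (- a)"
        by (rule mult_right_mono) simp
      also have "\<dots> \<le> 2 powr (- a / 2)" using a0 k by blast
      also have "\<dots> \<le> 2 powr (- real k / 2)" using k by (intro powr_mono) auto
      also have "\<dots> = (2 powr (-1/2)) ^ k" by (simp add: powr_powr flip: powr_realpow)
      finally show ?case
        using p_nonneg[of k] pos unfolding p_def a_def by (auto intro!: mult_right_mono)
    qed
  qed
qed

text \<open>Averaging: for each point the proportion of bad candidates is at most
  \<open>p k\<close>, so for some candidate the proportion of bad points is at most
  \<open>p k\<close>.\<close>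

lemma ex_grid_few_bad:
  assumes k: "2 \<le> k" and X: "finite X" "X \<subseteq> S"
  shows "\<exists>j<2 ^ (blk k - gap k - 1). real (card {x\<in>X. bad k (\<theta> + real j * (1/2) ^ blk k) x}) \<le> p k * real (card X)"
proof (rule ccontr)
  let ?J = "2 ^ (blk k - gap k - 1) :: nat"
  let ?n = "\<lambda>j. card {x\<in>X. bad k (\<theta> + real j * (1/2) ^ blk k) x}"
  assume "\<not> ?thesis"
  then have "p k * real (card X) < real (?n j)" if "j < ?J" for j using that by force
  then have "(\<Sum>j<?J. p k * real (card X)) < (\<Sum>j<?J. real (?n j))"
    by (intro sum_strict_mono) (auto simp: lessThan_empty_iff)
  also have "\<dots> = (\<Sum>x\<in>X. real (card {j\<in>{..<?J}. bad k (\<theta> + real j * (1/2) ^ blk k) x}))"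
    using card_swap[of "{..<?J}" X "\<lambda>j. bad k (\<theta> + real j * (1/2) ^ blk k)"] X
    by (simp only: finite_lessThan flip: of_nat_sum)
  also have "\<dots> \<le> (\<Sum>x\<in>X. p k * 2 ^ (blk k - gap k - 1))"
    using X by (intro sum_mono card_bad_le[OF k]) auto
  finally show False by (simp add: mult_ac)
qed

text \<open>The angles \<open>\<theta> k\<close> are built stage by stage, adding each time a
  multiple of the finer mesh supplied by \<open>ex_grid_few_bad\<close>; the shifts are so small
  that the limit stays in every window.\<close>

lemma ex_direction_few_bad:
  assumes k1: "2 \<le> k1" and X: "finite X" "X \<subseteq> S"
  obtains \<tau> \<theta> where "\<tau> \<in> Theta"
    "\<And>k. \<theta> k \<le> \<tau>" "\<And>k. \<tau> \<le> \<theta> k + (1/2) ^ gap (Suc k)"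
    "\<And>k. k1 \<le> k \<Longrightarrow> real (card {x\<in>X. bad k (\<theta> k) x}) \<le> p k * real (card X)"
proof -
  \<comment> \<open>A shift uses at most half of the current window and leaves the other half to all
    later shifts. Stages before \<open>k1\<close> make no demand on bad points, so there j = 0 will
    do.\<close>
  define Q where "Q k \<theta> j \<longleftrightarrow> real j * (1/2) ^ blk (Suc k) \<le> (1/2) ^ Suc (gap (Suc k)) \<and>
      (k1 \<le> Suc k \<longrightarrow> real (card {x\<in>X. bad (Suc k) (\<theta> + real j * (1/2) ^ blk (Suc k)) x}) \<le> p (Suc k) * real (card X))"
    for k \<theta> and j :: nat
  have "\<exists>j. Q k \<theta> j" for k \<theta>
  proof (cases "k1 \<le> Suc k")
    case True
    then have k: "2 \<le> Suc k" using k1 by simp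
    obtain j where j: "j < 2 ^ (blk (Suc k) - gap (Suc k) - 1)"
      "real (card {x\<in>X. bad (Suc k) (\<theta> + real j * (1/2) ^ blk (Suc k)) x}) \<le> p (Suc k) * real (card X)"
      using ex_grid_few_bad[OF k X] by blast
    have "blk (Suc k) - gap (Suc k) - 1 + Suc (gap (Suc k)) = blk (Suc k)"
      using gap_less_blk[OF k] by simp
    then have e: "2 ^ (blk (Suc k) - gap (Suc k) - 1) * (1/2) ^ blk (Suc k) = (1/2::real) ^ (Suc (gap (Suc k)))"
      using two_power_mult_half_power[of "blk (Suc k) - gap (Suc k) - 1" "Suc (gap (Suc k))"] by (simp only:)
    have "real j * (1/2) ^ blk (Suc k) \<le> 2 ^ (blk (Suc k) - gap (Suc k) - 1) * (1/2) ^ blk (Suc k)"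
    proof (rule mult_right_mono)
      have "real j \<le> real (2 ^ (blk (Suc k) - gap (Suc k) - 1))"
        by (rule of_nat_mono) (rule less_imp_le[OF j(1)])
      then show "real j \<le> 2 ^ (blk (Suc k) - gap (Suc k) - 1)" unfolding of_nat_power of_nat_numeral .
    qed simp
    then have "real j * (1/2) ^ blk (Suc k) \<le> (1/2) ^ Suc (gap (Suc k))" unfolding e .
    with j(2) show ?thesis unfolding Q_def by blast
  qed (auto simp: Q_def intro: exI[of _ 0])
  then obtain J where "\<And>k \<theta>. Q k \<theta> (J k \<theta>)" by metis
  then have J: "real (J k \<theta>) * (1/2) ^ blk (Suc k) \<le> (1/2) ^ Suc (gap (Suc k))"
      "k1 \<le> Suc k \<Longrightarrow> real (card {x\<in>X. bad (Suc k) (\<theta> + real (J k \<theta>) * (1/2) ^ blk (Suc k)) x}) \<le> p (Suc k) * real (card X)"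
    for k \<theta> unfolding Q_def by blast+
  define \<theta> where "\<theta> = rec_nat 0 (\<lambda>k \<theta>. \<theta> + real (J k \<theta>) * (1/2) ^ blk (Suc k))"
  have \<theta>0: "\<theta> 0 = 0" and \<theta>S: "\<theta> (Suc k) = \<theta> k + real (J k (\<theta> k)) * (1/2) ^ blk (Suc k)" for k
    by (simp_all add: \<theta>_def)
  have "incseq \<theta>" by (rule incseq_SucI) (simp add: \<theta>S)
  \<comment> \<open>The right ends of the windows do not increase: the next window is at most half
    as long, and the shift takes at most the other half.\<close>
  have up: "\<theta> (k + n) + (1/2) ^ gap (Suc (k + n)) \<le> \<theta> k + (1/2) ^ gap (Suc k)" for k n
  proof (induction n)
    case (Suc n)
    have "(1/2::real) ^ gap (Suc (Suc (k + n))) \<le> (1/2) ^ (Suc (gap (Suc (k + n))))"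
      using gap_mono_Suc[of "Suc (k + n)"] by (intro power_decreasing) auto
    then show ?case using Suc J(1)[of "k + n" "\<theta> (k + n)"] \<theta>S[of "k + n"] by simp
  qed simp
  have up': "\<theta> n \<le> \<theta> k + (1/2) ^ gap (Suc k)" if "k \<le> n" for k n
  proof -
    have "\<theta> n \<le> \<theta> n + (1/2) ^ gap (Suc n)" by simp
    also have "\<dots> \<le> \<theta> k + (1/2) ^ gap (Suc k)" using up[of k "n - k"] that by simp
    finally show ?thesis .
  qed
  have "gap (Suc 0) = 1" by (simp add: gap_def blk_def)
  then have bound: "\<theta> n \<le> 1 / 2" for n using up'[of 0 n] \<theta>0 by simp
  then obtain \<tau> where \<tau>: "\<theta> \<longlonglongrightarrow> \<tau>" "\<And>k. \<theta> k \<le> \<tau>"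
    using incseq_convergent[OF \<open>incseq \<theta>\<close>] by blast
  have \<tau>_le: "\<tau> \<le> \<theta> k + (1/2) ^ gap (Suc k)" for k
    using up' by (intro LIMSEQ_le_const2[OF \<tau>(1)]) auto
  \<comment> \<open>The grids are nested because \<open>blk\<close> increases, so a shift by a
    multiple of the finer mesh ends on the finer grid.\<close>
  have grid: "\<exists>i::nat. \<theta> k = real i * (1/2) ^ blk k" for k
  proof (induction k)
    case (Suc k)
    then obtain i where i: "\<theta> k = real i * (1/2) ^ blk k" by blast
    have "blk (Suc k) = (blk (Suc k) - blk k) + blk k" by (simp add: blk_Suc)
    then have "(1/2::real) ^ blk (Suc k) = (1/2) ^ (blk (Suc k) - blk k) * (1/2) ^ blk k"
      by (metis power_add)
    then have "\<theta> k = real (i * 2 ^ (blk (Suc k) - blk k)) * (1/2) ^ blk (Suc k)"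
      by (simp add: i power_divide)
    then have "\<theta> (Suc k) = real (i * 2 ^ (blk (Suc k) - blk k) + J k (\<theta> k)) * (1/2) ^ blk (Suc k)"
      unfolding \<theta>S[of k] of_nat_add distrib_right by (rule arg_cong)
    then show ?case by blast
  qed (auto simp: \<theta>0 intro: exI[of _ 0])
  have "\<exists>i::nat. real i * (1/2) ^ blk k \<le> \<tau> \<and> \<tau> \<le> real i * (1/2) ^ blk k + (1/2) ^ gap (Suc k)" for k
    using grid[of k] \<tau>(2)[of k] \<tau>_le[of k] by auto
  moreover have "0 \<le> \<tau>" "\<tau> \<le> 1"
    using \<tau>(2)[of 0] \<tau>_le[of 0] \<theta>0 \<open>gap (Suc 0) = 1\<close> by auto
  ultimately have "\<tau> \<in> Theta" by (auto simp: Theta_def)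
  moreover have "real (card {x\<in>X. bad k (\<theta> k) x}) \<le> p k * real (card X)" if "k1 \<le> k" for k
    using that k1 J(2)[of "k - 1" "\<theta> (k - 1)"] \<theta>S[of "k - 1"] by (cases k) auto
  ultimately show thesis using that[of \<tau> \<theta>] \<tau>(2) \<tau>_le by blast
qed

text \<open>Exchanging \<open>\<tau>\<close> for \<open>\<theta>\<close> changes the inner product
  by at most 2^(-\<open>blk k\<close>) times the distance \<open>4 * (1/2) ^ (m * blk k)\<close>,
  that is by \<open>4 * (1/2) ^ (Suc m * blk k)\<close>; this turns the factor 4 into 8.\<close>

lemma good_if_not_bad:
  assumes "\<theta> \<le> \<tau>" "\<tau> \<le> \<theta> + (1/2) ^ gap (Suc k)" "\<not> bad k \<theta> x"
  shows "good k \<tau> x"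
  unfolding good_def
proof
  fix m assume m: "m \<in> {k..<(k+1)^3}"
  have "hits 4 k m \<tau> x \<subseteq> hits 8 k m \<theta> x"
  proof
    fix y assume y: "y \<in> hits 4 k m \<tau> x"
    have "\<bar>dir \<theta> \<bullet> (x - y) - dir \<tau> \<bullet> (x - y)\<bar> \<le> \<bar>\<theta> - \<tau>\<bar> * norm (x - y)"
      by (rule abs_dir_inner_diff_le)
    also have "\<dots> \<le> (1/2) ^ blk k * (4 * (1/2) ^ (m * blk k))"
    proof (intro mult_mono)
      have "(1/2::real) ^ gap (Suc k) \<le> (1/2) ^ blk k"
        using blk_le_gap_Suc by (intro power_decreasing) auto
      then show "\<bar>\<theta> - \<tau>\<bar> \<le> (1/2) ^ blk k" using assms by linarith
    qed (use y in \<open>auto simp: hits_def dist_norm\<close>)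
    also have "\<dots> = 4 * (1/2) ^ (Suc m * blk k)" by (simp add: power_add)
    finally show "y \<in> hits 8 k m \<theta> x" using y by (auto simp: hits_def)
  qed
  then have "card (hits 4 k m \<tau> x) \<le> card (hits 8 k m \<theta> x)" by (intro card_mono) auto
  moreover have "real (card (hits 8 k m \<theta> x)) \<le> M k" using assms(3) m by (force simp: bad_def)
  ultimately show "real (card (hits 4 k m \<tau> x)) \<le> M k" by linarith
qed

text \<open>The points that are bad at some stage make up a proportion of at most the sum of the
  \<open>p k\<close>, hence at most one half.\<close>

lemma ex_direction_half_good:
  assumes k1: "2 \<le> k1" and half: "sum p {k1..<K} \<le> 1/2" and X: "finite X" "X \<subseteq> S"
  obtains \<tau> where "\<tau> \<in> Theta" "real (card X) \<le> 2 * real (card {x\<in>X. \<forall>k\<in>{k1..<K}. good k \<tau> x})"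
proof -
  obtain \<tau> \<theta> where \<tau>: "\<tau> \<in> Theta" "\<And>k. \<theta> k \<le> \<tau>" "\<And>k. \<tau> \<le> \<theta> k + (1/2) ^ gap (Suc k)"
    "\<And>k. k1 \<le> k \<Longrightarrow> real (card {x\<in>X. bad k (\<theta> k) x}) \<le> p k * real (card X)"
    by (rule ex_direction_few_bad[OF k1 X]) (rule that, assumption+)
  define G where "G = {x\<in>X. \<forall>k\<in>{k1..<K}. good k \<tau> x}"
  have "X \<subseteq> G \<union> (\<Union>k\<in>{k1..<K}. {x\<in>X. bad k (\<theta> k) x})"
    using good_if_not_bad[OF \<tau>(2,3)] by (auto simp: G_def)
  then have "card X \<le> card (G \<union> (\<Union>k\<in>{k1..<K}. {x\<in>X. bad k (\<theta> k) x}))"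
    using X by (intro card_mono) (auto simp: G_def)
  also have "\<dots> \<le> card G + card (\<Union>k\<in>{k1..<K}. {x\<in>X. bad k (\<theta> k) x})" by (rule card_Un_le)
  also have "\<dots> \<le> card G + (\<Sum>k\<in>{k1..<K}. card {x\<in>X. bad k (\<theta> k) x})"
    by (intro add_left_mono card_UN_le) simp
  finally have "real (card X) \<le> real (card G) + (\<Sum>k\<in>{k1..<K}. real (card {x\<in>X. bad k (\<theta> k) x}))"
    by (simp only: flip: of_nat_sum of_nat_add of_nat_le_iff)
  also have "\<dots> \<le> real (card G) + (\<Sum>k\<in>{k1..<K}. p k * real (card X))"
    using \<tau>(4) by (intro add_left_mono sum_mono) auto
  also have "\<dots> = real (card G) + sum p {k1..<K} * real (card X)" by (simp add: sum_distrib_right)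
  also have "\<dots> \<le> real (card G) + 1/2 * real (card X)"
    by (intro add_left_mono mult_right_mono half) simp
  finally show thesis using that[OF \<tau>(1)] by (simp add: G_def)
qed

end

section \<open>Counting net points in fibres\<close>

lemma half_power_eq_powr: "(1/2::real) ^ n = 2 powr (- real n)"
  by (simp add: powr_minus_divide powr_realpow power_one_over)

text \<open>The scale that ends stage k begins stage k + 1, so the stages form one increasing chain
  of scales; \<open>level_induct\<close> is induction along it.\<close>

lemma blk_level_Suc: "(k + 1) ^ 3 * blk k = Suc k * blk (Suc k)"
  by (simp add: blk_Suc power2_eq_square power3_eq_cube algebra_simps)

lemma le_cube_Suc: "k \<le> (k + 1 :: nat) ^ 3"
  using self_le_power[of "k + 1" 3] by simp

lemma level_induct:
  assumes "k0 \<le> K" and base: "P (k0 * blk k0)"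
    and step: "\<And>k m. \<lbrakk>k0 \<le> k; k < K; k \<le> m; m < (k + 1) ^ 3; P (m * blk k)\<rbrakk> \<Longrightarrow> P (Suc m * blk k)"
  shows "P (K * blk K)"
  using assms(1) step
proof (induction K rule: dec_induct)
  case (step k)
  have Pk: "P (k * blk k)"
  proof (rule step.IH)
    fix l m assume "k0 \<le> l" "l < k" "l \<le> m" "m < (l + 1) ^ 3" "P (m * blk l)"
    then show "P (Suc m * blk l)" using step.prems[of l m] by simp
  qed
  have up: "P (Suc m * blk k)" if "k \<le> m" "m < (k + 1) ^ 3" "P (m * blk k)" for m
    using step.prems[of k m] step.hyps that by simp
  have "P (m * blk k)" if "k \<le> m" "m \<le> (k + 1) ^ 3" for m
    using that
  proof (induction m rule: dec_induct)
    case (step m)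
    then show ?case by (intro up) auto
  qed (rule Pk)
  from this[OF le_cube_Suc order.refl] show ?case by (simp only: blk_level_Suc)
qed (rule base)

text \<open>Narrow sets take the place of pieces of a fibre: they lie in a strip of width r
  orthogonal to \<open>dir \<tau>\<close>.\<close>

definition narrow :: "real \<Rightarrow> real \<Rightarrow> (real^2) set \<Rightarrow> bool" where
  "narrow \<tau> r P \<longleftrightarrow> (\<forall>x\<in>P. \<forall>y\<in>P. \<bar>dir \<tau> \<bullet> (x - y)\<bar> \<le> r)"

lemma narrow_mono: "narrow \<tau> r P \<Longrightarrow> Q \<subseteq> P \<Longrightarrow> r \<le> r' \<Longrightarrow> narrow \<tau> r' Q"
  unfolding narrow_def by (meson order_trans subsetD)

context plane_net begin

text \<open>A bound for fibres at one scale, with the width of the strip equal to the radius of the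
  covering balls. It concerns only subsets of \<open>G\<close>, at whose points goodness will be
  known.\<close>

definition covered :: "real \<Rightarrow> (real^2) set \<Rightarrow> nat \<Rightarrow> real \<Rightarrow> bool" where
  "covered \<tau> G n N \<longleftrightarrow> (\<forall>P. P \<subseteq> G \<longrightarrow> narrow \<tau> ((1/2) ^ n) P \<longrightarrow>
     (\<exists>Z\<subseteq>Y n. real (card Z) \<le> N \<and> P \<subseteq> (\<Union>z\<in>Z. cball z ((1/2) ^ n))))"

lemma finite_subset_net: "Z \<subseteq> Y n \<Longrightarrow> finite Z"
  using net(1) finite_subset by blast

lemma covered_mono: "covered \<tau> G n N \<Longrightarrow> N \<le> N' \<Longrightarrow> covered \<tau> G n N'"
  unfolding covered_def by (meson order_trans)

text \<open>Each coarse ball that meets \<open>P\<close> is refined separately: some point x of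
  \<open>P\<close> in it is good, and the fine net points close to the rest of \<open>P\<close> in
  that ball are all hits of x.\<close>

lemma covered_step:
  assumes cov: "covered \<tau> G (m * blk k) N" and G: "G \<subseteq> S" and good: "\<And>x. x \<in> G \<Longrightarrow> good k \<tau> x"
    and m: "k \<le> m" "m < (k + 1) ^ 3"
  shows "covered \<tau> G (Suc m * blk k) (N * M k)"
  unfolding covered_def
proof (intro allI impI)
  fix P assume P: "P \<subseteq> G" "narrow \<tau> ((1/2) ^ (Suc m * blk k)) P"
  define \<rho> \<rho>' :: real where "\<rho> = (1/2) ^ (m * blk k)" and "\<rho>' = (1/2) ^ (Suc m * blk k)"
  have \<rho>: "0 < \<rho>" "0 < \<rho>'" "\<rho>' \<le> \<rho>" by (auto simp: \<rho>_def \<rho>'_def intro!: power_decreasing)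
  have nP: "narrow \<tau> \<rho> P" by (rule narrow_mono[OF P(2)[folded \<rho>'_def] order.refl \<rho>(3)])
  then obtain Z where Z: "Z \<subseteq> Y (m * blk k)" "real (card Z) \<le> N" "P \<subseteq> (\<Union>z\<in>Z. cball z \<rho>)"
    using cov[unfolded covered_def, rule_format, OF P(1), folded \<rho>_def, OF nP] by blast
  have fZ: "finite Z" using Z(1) by (rule finite_subset_net)
  have "\<exists>W\<subseteq>Y (Suc m * blk k). real (card W) \<le> M k \<and> P \<inter> cball z \<rho> \<subseteq> (\<Union>w\<in>W. cball w \<rho>')" for z
  proof (cases "P \<inter> cball z \<rho> = {}")
    case True
    then show ?thesis by (intro exI[of _ "{}"]) (auto simp: M_def)
  next
    case False
    then obtain x where x: "x \<in> P" "dist z x \<le> \<rho>" by auto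
    have "good k \<tau> x" using good P(1) x(1) by blast
    then have "real (card (hits 4 k m \<tau> x)) \<le> M k" using m by (auto simp: good_def)
    moreover have "P \<inter> cball z \<rho> \<subseteq> (\<Union>w\<in>hits 4 k m \<tau> x. cball w \<rho>')"
    proof
      fix x' assume x': "x' \<in> P \<inter> cball z \<rho>"
      then obtain y where y: "y \<in> Y (Suc m * blk k)" "dist x' y < \<rho>'"
        using net_near[of x' "Suc m * blk k"] P(1) G by (auto simp: \<rho>'_def)
      \<comment> \<open>The distance from x to y is at most \<open>3 * \<rho>\<close>; the
        projections differ by at most \<open>2 * \<rho>'\<close>, one part from the width of the
        strip and one from the distance of x' to y.\<close>
      have "dist x y \<le> dist x z + dist z x' + dist x' y"
        using dist_triangle[of x y z] dist_triangle[of z y x'] by linarith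
      also have "\<dots> \<le> 4 * \<rho>" using x x' y \<rho> by (simp add: dist_commute)
      finally have "dist x y \<le> 4 * \<rho>" .
      moreover have "\<bar>dir \<tau> \<bullet> (x - y)\<bar> \<le> 4 * \<rho>'"
      proof -
        have "\<bar>dir \<tau> \<bullet> (x' - y)\<bar> \<le> norm (dir \<tau>) * norm (x' - y)" by (rule Cauchy_Schwarz_ineq2)
        also have "\<dots> \<le> \<rho>'" using y(2) by (simp add: dist_norm)
        finally have "\<bar>dir \<tau> \<bullet> (x' - y)\<bar> \<le> \<rho>'" .
        moreover have "\<bar>dir \<tau> \<bullet> (x - x')\<bar> \<le> \<rho>'"
          using P(2) x(1) x' by (auto simp: narrow_def \<rho>'_def)
        moreover have "dir \<tau> \<bullet> (x - y) = dir \<tau> \<bullet> (x - x') + dir \<tau> \<bullet> (x' - y)"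
          by (simp add: inner_diff_right)
        ultimately show ?thesis using \<rho>(2) by linarith
      qed
      ultimately have "y \<in> hits 4 k m \<tau> x"
        using y(1) by (auto simp: hits_def \<rho>_def \<rho>'_def)
      then show "x' \<in> (\<Union>w\<in>hits 4 k m \<tau> x. cball w \<rho>')"
        using y(2) by (intro UN_I[of y]) (auto simp: dist_commute)
    qed
    ultimately show ?thesis by (intro exI[of _ "hits 4 k m \<tau> x"]) (auto simp: hits_def)
  qed
  then obtain W where W: "\<And>z. W z \<subseteq> Y (Suc m * blk k)" "\<And>z. real (card (W z)) \<le> M k"
    "\<And>z. P \<inter> cball z \<rho> \<subseteq> (\<Union>w\<in>W z. cball w \<rho>')" by metis
  have "card (\<Union>z\<in>Z. W z) \<le> (\<Sum>z\<in>Z. card (W z))" by (rule card_UN_le[OF fZ])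
  then have "real (card (\<Union>z\<in>Z. W z)) \<le> (\<Sum>z\<in>Z. real (card (W z)))"
    by (simp only: of_nat_le_iff flip: of_nat_sum)
  also have "\<dots> \<le> real (card Z) * M k" using W(2) by (rule sum_bounded_above)
  also have "\<dots> \<le> N * M k" using Z(2) by (intro mult_right_mono) (simp_all add: M_def)
  finally have "real (card (\<Union>z\<in>Z. W z)) \<le> N * M k" .
  moreover have "P \<subseteq> (\<Union>w\<in>(\<Union>z\<in>Z. W z). cball w \<rho>')" using Z(3) W(3) by blast
  moreover have "(\<Union>z\<in>Z. W z) \<subseteq> Y (Suc m * blk k)" using W(1) by blast
  ultimately show "\<exists>Z\<subseteq>Y (Suc m * blk k). real (card Z) \<le> N * M k \<and>
      P \<subseteq> (\<Union>z\<in>Z. cball z ((1/2) ^ (Suc m * blk k)))"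
    unfolding \<rho>'_def by blast
qed

lemma card_narrow_le:
  assumes cov: "covered \<tau> G n N" and G: "G \<subseteq> Y L" and n: "n \<le> L"
    and P: "P \<subseteq> G" "narrow \<tau> ((1/2) ^ n) P"
  shows "real (card P) \<le> N * (A * 2 powr ((real L - real n) * \<alpha>))"
proof -
  obtain Z where Z: "Z \<subseteq> Y n" "real (card Z) \<le> N" "P \<subseteq> (\<Union>z\<in>Z. cball z ((1/2) ^ n))"
    using cov[unfolded covered_def, rule_format, OF P] by blast
  have PL: "P \<subseteq> Y L" using P(1) G by (rule order_trans)
  have fP: "finite P" "P \<subseteq> S" "separated ((1/2) ^ L) P"
    using net[of L] finite_subset_net[OF PL] PL unfolding separated_def by blast+
  have fZ: "finite Z" using Z(1) by (rule finite_subset_net)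
  have "real (card (P \<inter> cball z ((1/2) ^ n))) \<le> A * 2 powr ((real L - real n) * \<alpha>)" if z: "z \<in> Z" for z
  proof -
    have "real (card (P \<inter> cball z ((1/2) ^ n))) \<le> A * ((1/2) ^ n / (1/2) ^ L) powr \<alpha>"
      using z Z(1) net(2)[of n] fP n by (intro upper[of z]) (auto simp: separated_def intro: power_decreasing)
    also have "(1/2::real) ^ n / (1/2) ^ L = 2 powr (real L - real n)"
      by (simp add: powr_diff powr_realpow power_divide)
    finally show ?thesis by (simp add: powr_powr)
  qed
  then have "(\<Sum>z\<in>Z. real (card (P \<inter> cball z ((1/2) ^ n)))) \<le> real (card Z) * (A * 2 powr ((real L - real n) * \<alpha>))"
    by (rule sum_bounded_above)
  moreover have "card P \<le> (\<Sum>z\<in>Z. card (P \<inter> cball z ((1/2) ^ n)))"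
  proof -
    have "P = (\<Union>z\<in>Z. P \<inter> cball z ((1/2) ^ n))" using Z(3) by blast
    then show ?thesis using card_UN_le[OF fZ, of "\<lambda>z. P \<inter> cball z ((1/2) ^ n)"] by simp
  qed
  then have "real (card P) \<le> (\<Sum>z\<in>Z. real (card (P \<inter> cball z ((1/2) ^ n))))"
    by (simp only: of_nat_le_iff flip: of_nat_sum)
  moreover have "real (card Z) * (A * 2 powr ((real L - real n) * \<alpha>)) \<le> N * (A * 2 powr ((real L - real n) * \<alpha>))"
    using Z(2) pos by (intro mult_right_mono) auto
  ultimately show ?thesis by linarith
qed

text \<open>A Frostman bound for counting measure: the net \<open>Y L\<close> has about 2^(L *
  \<open>\<alpha>\<close>) points, and a strip of width r carries a share of order r^t. Rounding r
  to the scale n costs a factor 1 + \<open>\<epsilon>\<close> in the exponent.\<close>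

lemma card_narrow_le_powr:
  assumes t: "0 < t" "(1 + \<epsilon>) * t \<le> \<alpha> - \<beta> - \<epsilon>" and N: "0 \<le> N"
    and cov: "covered \<tau> G n (N * 2 powr (real n * (\<beta> + \<epsilon>)))" and G: "G \<subseteq> Y L" and n: "n \<le> L"
    and r: "r \<le> (1/2) ^ n" "(1/2) ^ n' \<le> r" "real n' \<le> real n * (1 + \<epsilon>)"
    and P: "P \<subseteq> G" "narrow \<tau> r P"
  shows "real (card P) \<le> N * A * 2 powr (real L * \<alpha>) * r powr t"
proof -
  have "real (card P) \<le> N * 2 powr (real n * (\<beta> + \<epsilon>)) * (A * 2 powr ((real L - real n) * \<alpha>))"
    using P r by (intro card_narrow_le[OF cov G n]) (auto intro: narrow_mono)
  also have "\<dots> = N * A * (2 powr (real n * (\<beta> + \<epsilon>)) * 2 powr ((real L - real n) * \<alpha>))" by simp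
  also have "2 powr (real n * (\<beta> + \<epsilon>)) * 2 powr ((real L - real n) * \<alpha>)
      = 2 powr (real L * \<alpha>) * 2 powr (- (real n * (\<alpha> - \<beta> - \<epsilon>)))"
    unfolding powr_add[symmetric] by (simp add: algebra_simps)
  also have "N * A * (2 powr (real L * \<alpha>) * 2 powr (- (real n * (\<alpha> - \<beta> - \<epsilon>))))
      \<le> N * A * (2 powr (real L * \<alpha>) * r powr t)"
  proof (intro mult_left_mono)
    have "real n' * t \<le> real n * (1 + \<epsilon>) * t" using r(3) t by (intro mult_right_mono) auto
    also have "\<dots> \<le> real n * (\<alpha> - \<beta> - \<epsilon>)" unfolding mult.assoc using t(2) by (intro mult_left_mono) auto
    finally have "2 powr (- (real n * (\<alpha> - \<beta> - \<epsilon>))) \<le> 2 powr (- (real n' * t))" by simp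
    also have "\<dots> = ((1/2) ^ n') powr t"
      by (simp only: half_power_eq_powr powr_powr minus_mult_left)
    also have "\<dots> \<le> r powr t" using r(2) t by (intro powr_mono2) auto
    finally show "2 powr (- (real n * (\<alpha> - \<beta> - \<epsilon>))) \<le> r powr t" .
  qed (use N pos in auto)
  finally show ?thesis by (simp add: mult.assoc)
qed

text \<open>The chain of scales is followed from \<open>k0 * blk k0\<close>, where the entire net
  serves as cover and gives the constant, to \<open>K * blk K\<close>.\<close>

lemma card_narrow_le_all_scales:
  assumes t: "0 < t" "(1 + \<epsilon>) * t \<le> \<alpha> - \<beta> - \<epsilon>"
    and k0: "0 < \<epsilon>" "2 \<le> \<epsilon> * real k0" "k0 \<le> K"
    and G: "G \<subseteq> Y (K * blk K)" and good: "\<And>x k. x \<in> G \<Longrightarrow> k0 \<le> k \<Longrightarrow> k < K \<Longrightarrow> good k \<tau> x"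
    and r: "(1/2) ^ (K * blk K) \<le> r" "r \<le> (1/2) ^ (k0 * blk k0)"
    and P: "P \<subseteq> G" "narrow \<tau> r P"
  shows "real (card P) \<le> real (card (Y (k0 * blk k0))) * A * 2 powr (real (K * blk K) * \<alpha>) * r powr t"
proof -
  define N where "N = real (card (Y (k0 * blk k0)))"
  define L where "L = K * blk K"
  have N0: "0 \<le> N" by (simp add: N_def)
  have GS: "G \<subseteq> S" using G net(2) by blast
  \<comment> \<open>The induction carries the covering bound at scale n together with the Frostman
    bound for all widths down to 2^(-n).\<close>
  define \<Phi> where "\<Phi> n \<longleftrightarrow> covered \<tau> G n (N * 2 powr (real n * (\<beta> + \<epsilon>))) \<and>
    (\<forall>r P. (1/2) ^ n \<le> r \<longrightarrow> r \<le> (1/2) ^ (k0 * blk k0) \<longrightarrow> P \<subseteq> G \<longrightarrow> narrow \<tau> r P \<longrightarrow>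
       real (card P) \<le> N * A * 2 powr (real L * \<alpha>) * r powr t)" for n
  have "K * blk K \<le> K * blk K \<longrightarrow> \<Phi> (K * blk K)"
  proof (rule level_induct[OF k0(3), where P = "\<lambda>n. n \<le> K * blk K \<longrightarrow> \<Phi> n"])
    show "k0 * blk k0 \<le> K * blk K \<longrightarrow> \<Phi> (k0 * blk k0)"
    proof
      assume le: "k0 * blk k0 \<le> K * blk K"
      have "covered \<tau> G (k0 * blk k0) N"
        unfolding covered_def
      proof (intro allI impI exI[of _ "Y (k0 * blk k0)"] conjI)
        fix P assume "P \<subseteq> G"
        show "P \<subseteq> (\<Union>z\<in>Y (k0 * blk k0). cball z ((1/2) ^ (k0 * blk k0)))"
        proof
          fix x assume "x \<in> P"
          then obtain y where "y \<in> Y (k0 * blk k0)" "dist x y < (1/2) ^ (k0 * blk k0)"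
            using net_near \<open>P \<subseteq> G\<close> GS by blast
          then show "x \<in> (\<Union>z\<in>Y (k0 * blk k0). cball z ((1/2) ^ (k0 * blk k0)))"
            by (intro UN_I[of y]) (auto simp: dist_commute)
        qed
      qed (simp_all add: N_def)
      moreover have "1 \<le> 2 powr (real (k0 * blk k0) * (\<beta> + \<epsilon>))"
        using k0(1) by (intro ge_one_powr_ge_zero) (auto simp: \<beta>_def)
      ultimately have cov: "covered \<tau> G (k0 * blk k0) (N * 2 powr (real (k0 * blk k0) * (\<beta> + \<epsilon>)))"
        using mult_left_mono[OF _ N0, of 1] by (elim covered_mono) simp
      show "\<Phi> (k0 * blk k0)"
        unfolding \<Phi>_def
      proof (intro conjI allI impI cov)
        fix r P assume *: "(1/2) ^ (k0 * blk k0) \<le> r" "r \<le> (1/2) ^ (k0 * blk k0)" "P \<subseteq> G" "narrow \<tau> r P"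
        have "real (k0 * blk k0) \<le> real (k0 * blk k0) * (1 + \<epsilon>)"
          using k0(1) by (simp add: distrib_left)
        then show "real (card P) \<le> N * A * 2 powr (real L * \<alpha>) * r powr t"
          using card_narrow_le_powr[OF t N0 cov, of L r "k0 * blk k0" P] G le * by (simp add: L_def)
      qed
    qed
  next
    fix k m assume km: "k0 \<le> k" "k < K" "k \<le> m" "m < (k + 1) ^ 3"
      and IH: "m * blk k \<le> K * blk K \<longrightarrow> \<Phi> (m * blk k)"
    show "Suc m * blk k \<le> K * blk K \<longrightarrow> \<Phi> (Suc m * blk k)"
    proof
      assume le: "Suc m * blk k \<le> K * blk K"
      then have le': "m * blk k \<le> L" by (simp add: L_def)
      then have \<Phi>: "\<Phi> (m * blk k)" using IH by (simp add: L_def)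
      then have cov: "covered \<tau> G (m * blk k) (N * 2 powr (real (m * blk k) * (\<beta> + \<epsilon>)))"
        by (simp add: \<Phi>_def)
      have kpos: "0 < k" using km(1) k0 by (cases k0) auto
      \<comment> \<open>This is used twice: the margin 2^(2 * \<open>gap k\<close>) in
        \<open>M k\<close> is at most 2^(\<open>\<epsilon> * blk k\<close>), and the exponents of
        consecutive scales have ratio at most 1 + \<open>\<epsilon>\<close>.\<close>
      have \<epsilon>k: "2 \<le> \<epsilon> * real k"
        by (rule order_trans[OF k0(2) mult_left_mono]) (use k0(1) km(1) in auto)
      have "M k \<le> 2 powr (real (blk k) * (\<beta> + \<epsilon>))"
      proof -
        have "2 * real (gap k) \<le> \<epsilon> * real k * real (gap k)"
          by (intro mult_right_mono \<epsilon>k) simp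
        then have "2 * real (gap k) \<le> real (blk k) * \<epsilon>"
          using kpos by (simp add: blk_eq_gap mult_ac)
        then show ?thesis by (simp add: M_def distrib_left)
      qed
      then have "N * 2 powr (real (m * blk k) * (\<beta> + \<epsilon>)) * M k
          \<le> N * 2 powr (real (m * blk k) * (\<beta> + \<epsilon>)) * 2 powr (real (blk k) * (\<beta> + \<epsilon>))"
        using N0 by (intro mult_left_mono) auto
      also have "\<dots> = N * 2 powr (real (Suc m * blk k) * (\<beta> + \<epsilon>))"
        unfolding mult.assoc[of N] powr_add[symmetric] by (simp add: algebra_simps)
      finally have NM: "N * 2 powr (real (m * blk k) * (\<beta> + \<epsilon>)) * M k
          \<le> N * 2 powr (real (Suc m * blk k) * (\<beta> + \<epsilon>))" .
      have "covered \<tau> G (Suc m * blk k) (N * 2 powr (real (m * blk k) * (\<beta> + \<epsilon>)) * M k)"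
        using good km by (intro covered_step[OF cov GS]) auto
      then have cov': "covered \<tau> G (Suc m * blk k) (N * 2 powr (real (Suc m * blk k) * (\<beta> + \<epsilon>)))"
        by (rule covered_mono[OF _ NM])
      show "\<Phi> (Suc m * blk k)"
        unfolding \<Phi>_def
      proof (intro conjI allI impI cov')
        fix r P assume *: "(1/2) ^ (Suc m * blk k) \<le> r" "r \<le> (1/2) ^ (k0 * blk k0)" "P \<subseteq> G" "narrow \<tau> r P"
        show "real (card P) \<le> N * A * 2 powr (real L * \<alpha>) * r powr t"
        proof (cases "(1/2) ^ (m * blk k) \<le> r")
          case True
          then show ?thesis using \<Phi> * by (simp add: \<Phi>_def)
        next
          \<comment> \<open>The width falls between two consecutive scales, and the covering bound
            at the coarser one applies.\<close>
          case False
          have "\<epsilon> * real k \<le> \<epsilon> * real m" using km(3) k0(1) by (intro mult_left_mono) auto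
          then have "1 * real (blk k) \<le> \<epsilon> * real m * real (blk k)"
            using \<epsilon>k by (intro mult_right_mono) auto
          then have "real (Suc m * blk k) \<le> real (m * blk k) * (1 + \<epsilon>)"
            by (simp add: algebra_simps)
          then show ?thesis
            using False * by (intro card_narrow_le_powr[OF t N0 cov G[folded L_def] le' _ *(1)]) auto
        qed
      qed
    qed
  qed
  then have "\<Phi> L" by (simp add: L_def)
  then show ?thesis using r P unfolding \<Phi>_def L_def N_def by blast
qed

text \<open>Mass distribution: at least half of a net of at least c * 2^(L *
  \<open>\<alpha>\<close>) points is good, and the strip over each \<open>I i\<close> holds at most
  its Frostman share. The power of 2 cancels, so the resulting bound is uniform in
  \<open>K\<close>.\<close>

lemma sum_powr_cover_ge:
  assumes t: "0 < t" "(1 + \<epsilon>) * t \<le> \<alpha> - \<beta> - \<epsilon>"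
    and k0: "0 < \<epsilon>" "2 \<le> \<epsilon> * real k0" "k0 \<le> K"
    and half: "real (card (Y (K * blk K))) \<le> 2 * real (card {x\<in>Y (K * blk K). \<forall>k\<in>{k0..<K}. good k \<tau> x})"
    and F: "finite F" "(\<lambda>x. dir \<tau> \<bullet> x) ` S \<subseteq> (\<Union>i\<in>F. I i)"
      "\<And>i. i \<in> F \<Longrightarrow> (1/2) ^ (K * blk K) \<le> r i" "\<And>i. i \<in> F \<Longrightarrow> r i \<le> (1/2) ^ (k0 * blk k0)"
      "\<And>i a b. i \<in> F \<Longrightarrow> a \<in> I i \<Longrightarrow> b \<in> I i \<Longrightarrow> \<bar>a - b\<bar> \<le> r i"
  shows "c \<le> 2 * real (card (Y (k0 * blk k0))) * A * (\<Sum>i\<in>F. r i powr t)"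
proof -
  define L where "L = K * blk K"
  define N where "N = real (card (Y (k0 * blk k0)))"
  define G where "G = {x\<in>Y L. \<forall>k\<in>{k0..<K}. good k \<tau> x}"
  have "S \<subseteq> (\<Union>x\<in>Y L. cball x ((1/2) ^ L))"
  proof
    fix x assume "x \<in> S"
    then obtain y where "y \<in> Y L" "dist x y < (1/2) ^ L" using net_near by blast
    then show "x \<in> (\<Union>x\<in>Y L. cball x ((1/2) ^ L))" by (intro UN_I[of y]) (auto simp: dist_commute)
  qed
  then have "c * ((1/2) ^ L) powr (-\<alpha>) \<le> real (card (Y L))"
    using net[of L] by (intro lower) auto
  also have "((1/2) ^ L) powr (-\<alpha>) = (2 powr (- real L)) powr (-\<alpha>)"
    by (simp only: half_power_eq_powr)
  also have "\<dots> = 2 powr (real L * \<alpha>)" by (simp only: powr_powr minus_mult_minus)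
  also have "real (card (Y L)) \<le> 2 * real (card G)" using half by (simp add: G_def L_def)
  also have "real (card G) \<le> (\<Sum>i\<in>F. N * A * 2 powr (real L * \<alpha>) * r i powr t)"
  proof -
    define P where "P i = {x\<in>G. dir \<tau> \<bullet> x \<in> I i}" for i
    have "G \<subseteq> (\<Union>i\<in>F. P i)" using F(2) net(2)[of L] by (fastforce simp: P_def G_def)
    then have "G = (\<Union>i\<in>F. P i)" by (auto simp: P_def)
    then have "card G \<le> (\<Sum>i\<in>F. card (P i))" using card_UN_le[OF F(1), of P] by simp
    then have "real (card G) \<le> (\<Sum>i\<in>F. real (card (P i)))" by (simp only: of_nat_le_iff flip: of_nat_sum)
    also have "\<dots> \<le> (\<Sum>i\<in>F. N * A * 2 powr (real L * \<alpha>) * r i powr t)"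
    proof (intro sum_mono)
      fix i assume i: "i \<in> F"
      have "narrow \<tau> (r i) (P i)"
        using F(5)[OF i] by (auto simp: narrow_def P_def inner_diff_right)
      then show "real (card (P i)) \<le> N * A * 2 powr (real L * \<alpha>) * r i powr t"
        unfolding N_def L_def using F(3,4)[OF i]
        by (intro card_narrow_le_all_scales[OF t k0, of G \<tau>]) (auto simp: G_def L_def P_def)
    qed
    finally show ?thesis .
  qed
  also have "2 * (\<Sum>i\<in>F. N * A * 2 powr (real L * \<alpha>) * r i powr t)
      = 2 * N * A * (\<Sum>i\<in>F. r i powr t) * 2 powr (real L * \<alpha>)"
    by (simp add: sum_distrib_left mult_ac)
  finally have "c * 2 powr (real L * \<alpha>) \<le> 2 * N * A * (\<Sum>i\<in>F. r i powr t) * 2 powr (real L * \<alpha>)" by simp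
  then show ?thesis by (simp add: N_def)
qed

end

section \<open>Universality\<close>

context plane_net begin

text \<open>The direction is a limit of directions that are good for half of finer and finer nets.
  If its projection were null, a finite cover with small sum of powers would, slightly enlarged,
  also cover the projection in an approximating direction, contradicting
  \<open>sum_powr_cover_ge\<close>.\<close>

lemma ex_direction_positive_projection:
  obtains \<theta> where "\<theta> \<in> Theta"
    "\<And>t. 0 < t \<Longrightarrow> t < min \<alpha> 1 \<Longrightarrow> hausdorff_measure t ((\<lambda>x. dir \<theta> \<bullet> x) ` S) \<noteq> 0"
proof -
  \<comment> \<open>The tail of the series beyond \<open>k'\<close> is small. This threshold depends
    neither on \<open>K\<close> nor on t, so one limit direction serves all t.\<close>
  obtain k' where k': "\<And>m n. k' \<le> m \<Longrightarrow> norm (sum p {m..<n}) < 1/2"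
    using summable_p[unfolded summable_Cauchy, rule_format, of "1/2"] by auto
  define k1 where "k1 = max k' 2"
  have "\<forall>K. \<exists>\<tau>. \<tau> \<in> Theta \<and>
      real (card (Y (K * blk K))) \<le> 2 * real (card {x\<in>Y (K * blk K). \<forall>k\<in>{k1..<K}. good k \<tau> x})"
  proof
    fix K
    show "\<exists>\<tau>. \<tau> \<in> Theta \<and>
      real (card (Y (K * blk K))) \<le> 2 * real (card {x\<in>Y (K * blk K). \<forall>k\<in>{k1..<K}. good k \<tau> x})"
    proof (rule ex_direction_half_good[of k1 K "Y (K * blk K)"])
      show "sum p {k1..<K} \<le> 1/2" using k'[of k1 K] by (simp add: k1_def)
    qed (use net in \<open>auto simp: k1_def\<close>)
  qed
  from choice[OF this] obtain T where T: "T K \<in> Theta"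
    "real (card (Y (K * blk K))) \<le> 2 * real (card {x\<in>Y (K * blk K). \<forall>k\<in>{k1..<K}. good k (T K) x})" for K
    by blast
  obtain \<theta> \<sigma> where \<theta>: "\<theta> \<in> Theta" "strict_mono (\<sigma> :: nat \<Rightarrow> nat)" "(T \<circ> \<sigma>) \<longlonglongrightarrow> \<theta>"
    using compact_Theta[unfolded compact_def, rule_format, of T] T(1) by blast
  have "hausdorff_measure t ((\<lambda>x. dir \<theta> \<bullet> x) ` S) \<noteq> 0" if t: "0 < t" "t < min \<alpha> 1" for t
  proof
    assume null: "hausdorff_measure t ((\<lambda>x. dir \<theta> \<bullet> x) ` S) = 0"
    \<comment> \<open>As t < 1, \<open>(1 + \<epsilon>) * t\<close> is at most t +
      \<open>\<epsilon>\<close>, which with this choice equals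
      \<open>\<alpha> - \<beta> - \<epsilon>\<close>.\<close>
    define \<epsilon> where "\<epsilon> = (\<alpha> - \<beta> - t) / 2"
    have s: "\<alpha> - \<beta> = min \<alpha> 1" by (auto simp: \<beta>_def)
    then have \<epsilon>: "0 < \<epsilon>" using t by (simp add: \<epsilon>_def)
    have "\<epsilon> * t \<le> \<epsilon> * 1" using t \<epsilon> by (intro mult_left_mono) auto
    moreover have "2 * \<epsilon> = \<alpha> - \<beta> - t" by (simp add: \<epsilon>_def)
    ultimately have t\<epsilon>: "(1 + \<epsilon>) * t \<le> \<alpha> - \<beta> - \<epsilon>" by (simp add: distrib_right)
    define k0 where "k0 = max k1 (nat \<lceil>2 / \<epsilon>\<rceil>)"
    have "2 / \<epsilon> \<le> real k0" unfolding k0_def by linarith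
    then have k0: "2 \<le> \<epsilon> * real k0" "k1 \<le> k0"
      using \<epsilon> by (auto simp: k0_def pos_divide_le_eq mult.commute)
    define N where "N = real (card (Y (k0 * blk k0)))"
    define \<rho> :: real where "\<rho> = (1/2) ^ (k0 * blk k0)"
    \<comment> \<open>The 1 keeps the denominator positive and makes
      \<open>2 * N * A * \<kappa>\<close> smaller than c. The term \<open>\<rho> powr t\<close> in
      \<open>\<eta>\<close> forces the widths of the finite cover to be at most
      \<open>\<rho>\<close>.\<close>
    define \<kappa> where "\<kappa> = c / (2 * N * A + 1)"
    define \<eta> where "\<eta> = min \<kappa> (\<rho> powr t)"
    have NA: "0 \<le> 2 * N * A" using pos by (simp add: N_def)
    have \<rho>: "0 < \<rho>" by (simp add: \<rho>_def)
    have \<kappa>: "0 < \<kappa>" unfolding \<kappa>_def by (intro divide_pos_pos add_nonneg_pos NA pos) simp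
    have \<eta>: "0 < \<eta>" using \<kappa> \<rho> by (simp add: \<eta>_def)
    have "hausdorff_content t 1 ((\<lambda>x. dir \<theta> \<bullet> x) ` S) < ennreal (\<eta> / 2)"
      using hausdorff_content_le_measure[of 1 t "(\<lambda>x. dir \<theta> \<bullet> x) ` S"] null \<eta> by simp
    then obtain U where U: "U \<in> diam_covers 1 ((\<lambda>x. dir \<theta> \<bullet> x) ` S)"
      "(\<Sum>n. diam_pow t (U n)) < ennreal (\<eta> / 2)"
      by (rule hausdorff_content_less_cover)
    have bU: "bounded (U n)" for n using U(1) by (simp add: diam_covers_def)
    define d where "d n = diameter (U n)" for n
    have d0: "0 \<le> d n" for n by (simp add: d_def diameter_ge_0 bU)
    have dp: "diam_pow t (U n) = ennreal (d n powr t)" for n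
      using t by (simp add: diam_pow_def d_def)
    \<comment> \<open>Adding a summable amount to the powers makes the widths \<open>r n\<close>
      strictly larger than the diameters \<open>d n\<close>, even where these are 0. The slack is
      spent in four parts \<open>g n\<close>: on each side, one for opening the cover and one for
      turning the direction.\<close>
    define a where "a n = d n powr t + \<eta> / 2 * (1/2) ^ Suc n" for n
    define r where "r n = a n powr (1 / t)" for n
    define g where "g n = (r n - d n) / 4" for n
    have a0: "0 < a n" for n using \<eta> by (simp add: a_def add_nonneg_pos)
    have r0: "0 < r n" and ra: "r n powr t = a n" for n
      using a0[of n] t by (auto simp: r_def powr_powr)
    have "d n < r n" for n
    proof -
      have "d n powr t < r n powr t" unfolding ra using \<eta> by (simp add: a_def)
      then show ?thesis using t d0[of n] r0[of n] by (meson linorder_not_less order_less_le powr_mono2)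
    qed
    then have g0: "0 < g n" for n by (simp add: g_def)
    have cpt: "compact ((\<lambda>x. dir \<theta> \<bullet> x) ` S)"
      by (intro compact_continuous_image compact continuous_intros)
    have "(\<lambda>x. dir \<theta> \<bullet> x) ` S \<subseteq> (\<Union>n. \<Union>u\<in>U n. ball u (g n))"
    proof
      fix z assume "z \<in> (\<lambda>x. dir \<theta> \<bullet> x) ` S"
      then obtain n where "z \<in> U n" using U(1) by (auto simp: diam_covers_def)
      then show "z \<in> (\<Union>n. \<Union>u\<in>U n. ball u (g n))" using g0[of n] by (intro UN_I[of n] UN_I[of z]) auto
    qed
    then obtain F where F: "finite F" "(\<lambda>x. dir \<theta> \<bullet> x) ` S \<subseteq> (\<Union>n\<in>F. \<Union>u\<in>U n. ball u (g n))"
      by (rule compactE_image[OF cpt, of UNIV, rotated]) auto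
    have sum_a: "(\<Sum>n\<in>F. a n) < \<eta>"
    proof -
      have "ennreal (\<Sum>n\<in>F. d n powr t) = (\<Sum>n\<in>F. diam_pow t (U n))" by (simp add: dp)
      also have "\<dots> \<le> (\<Sum>n. diam_pow t (U n))" by (intro sum_le_suminf F) auto
      also note U(2)
      finally have "(\<Sum>n\<in>F. d n powr t) < \<eta> / 2"
        by (subst (asm) ennreal_less_iff) (auto intro: sum_nonneg)
      moreover have "(\<Sum>n\<in>F. (1/2::real) ^ Suc n) \<le> 1"
        using sum_le_suminf[OF sums_summable[OF power_half_series] F(1)] sums_unique[OF power_half_series] by simp
      then have "\<eta> / 2 * (\<Sum>n\<in>F. (1/2) ^ Suc n) \<le> \<eta> / 2 * 1"
        using \<eta> by (intro mult_left_mono) auto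
      ultimately show ?thesis by (simp add: a_def sum.distrib sum_distrib_left)
    qed
    have r_le: "r n \<le> \<rho>" if n: "n \<in> F" for n
    proof -
      have "a n \<le> (\<Sum>n\<in>F. a n)" using a0 F(1) n by (intro member_le_sum) (auto intro: less_imp_le)
      then have "r n powr t < \<rho> powr t" using sum_a by (simp add: ra \<eta>_def)
      then show ?thesis using t \<rho> by (meson linorder_not_less order_less_le powr_mono2)
    qed
    define g1 where "g1 = Min (insert 1 (g ` F))"
    have g1: "0 < g1" "\<And>n. n \<in> F \<Longrightarrow> g1 \<le> g n"
      using F(1) g0 by (auto simp: g1_def)
    obtain B where B: "0 < B" "\<And>x. x \<in> S \<Longrightarrow> norm x \<le> B"
      using compact_imp_bounded[OF compact] unfolding bounded_pos by blast
    have "\<forall>\<^sub>F i in sequentially. dist (T (\<sigma> i)) \<theta> < g1 / B"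
      using \<theta>(3) g1(1) B(1) by (intro tendstoD) (auto simp: comp_def)
    moreover have "(\<lambda>n. (1/2::real) ^ n) \<longlonglongrightarrow> 0" by (rule LIMSEQ_realpow_zero) auto
    then have "\<forall>\<^sub>F i in sequentially. (1/2) ^ i < g1"
      using g1(1) by (rule order_tendstoD)
    ultimately have "\<forall>\<^sub>F i in sequentially. dist (T (\<sigma> i)) \<theta> < g1 / B \<and> (1/2) ^ i < g1 \<and> k0 \<le> i"
      using eventually_ge_at_top[of k0] by eventually_elim auto
    then obtain i where i: "dist (T (\<sigma> i)) \<theta> < g1 / B" "(1/2) ^ i < g1" "k0 \<le> i"
      using eventually_happens'[OF sequentially_bot] by blast
    define K \<tau> where "K = \<sigma> i" and "\<tau> = T K"
    have iK: "i \<le> K" using seq_suble[OF \<theta>(2)] by (simp add: K_def)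
    have close: "\<bar>dir \<tau> \<bullet> x - dir \<theta> \<bullet> x\<bar> < g1" if x: "x \<in> S" for x
    proof -
      have "\<bar>dir \<tau> \<bullet> x - dir \<theta> \<bullet> x\<bar> \<le> \<bar>\<tau> - \<theta>\<bar> * norm x" by (rule abs_dir_inner_diff_le)
      also have "\<dots> \<le> \<bar>\<tau> - \<theta>\<bar> * B" using B(2)[OF x] by (intro mult_left_mono) auto
      also have "\<dots> < g1" using i(1) B(1) by (simp add: \<tau>_def K_def dist_real_def pos_less_divide_eq)
      finally show ?thesis .
    qed
    have "c \<le> 2 * real (card (Y (k0 * blk k0))) * A * (\<Sum>n\<in>F. r n powr t)"
    proof (rule sum_powr_cover_ge[OF t(1) t\<epsilon> \<epsilon> k0(1), where K = K and \<tau> = \<tau> and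
          I = "\<lambda>n. {b. \<exists>u\<in>U n. \<bar>b - u\<bar> < 2 * g n}"])
      show "k0 \<le> K" using i(3) iK by simp
      have "real (card (Y (K * blk K))) \<le> 2 * real (card {x\<in>Y (K * blk K). \<forall>k\<in>{k1..<K}. good k \<tau> x})"
        unfolding \<tau>_def by (rule T(2))
      also have "card {x\<in>Y (K * blk K). \<forall>k\<in>{k1..<K}. good k \<tau> x}
          \<le> card {x\<in>Y (K * blk K). \<forall>k\<in>{k0..<K}. good k \<tau> x}"
        using net(1) k0(2) by (intro card_mono) auto
      finally show "real (card (Y (K * blk K))) \<le> 2 * real (card {x\<in>Y (K * blk K). \<forall>k\<in>{k0..<K}. good k \<tau> x})"
        by simp
      show "finite F" by fact
      show "(\<lambda>x. dir \<tau> \<bullet> x) ` S \<subseteq> (\<Union>n\<in>F. {b. \<exists>u\<in>U n. \<bar>b - u\<bar> < 2 * g n})"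
      proof
        fix z assume "z \<in> (\<lambda>x. dir \<tau> \<bullet> x) ` S"
        then obtain x where x: "x \<in> S" "z = dir \<tau> \<bullet> x" by blast
        then obtain n u where nu: "n \<in> F" "u \<in> U n" "dist u (dir \<theta> \<bullet> x) < g n"
          using F(2) by force
        have "\<bar>z - u\<bar> < 2 * g n"
          using nu close[OF x(1)] g1(2)[OF nu(1)] by (simp add: x(2) dist_real_def)
        then show "z \<in> (\<Union>n\<in>F. {b. \<exists>u\<in>U n. \<bar>b - u\<bar> < 2 * g n})" using nu by blast
      qed
      fix n assume n: "n \<in> F"
      show "r n \<le> (1/2) ^ (k0 * blk k0)" using r_le[OF n] by (simp add: \<rho>_def)
      \<comment> \<open>The index i was chosen with 2^(-i) below every slack, hence below every
        width.\<close>
      have "i \<le> K * blk K" using iK blk_pos[of K] by (cases "blk K") auto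
      then have "(1/2::real) ^ (K * blk K) \<le> (1/2) ^ i" by (intro power_decreasing) auto
      also have "\<dots> \<le> r n" using i(2) g1(2)[OF n] d0[of n] g0[of n] by (simp add: g_def)
      finally show "(1/2) ^ (K * blk K) \<le> r n" .
      fix b b' assume "b \<in> {b. \<exists>u\<in>U n. \<bar>b - u\<bar> < 2 * g n}" "b' \<in> {b. \<exists>u\<in>U n. \<bar>b - u\<bar> < 2 * g n}"
      then obtain u u' where u: "u \<in> U n" "u' \<in> U n" "\<bar>b - u\<bar> < 2 * g n" "\<bar>b' - u'\<bar> < 2 * g n" by blast
      have "\<bar>u - u'\<bar> \<le> d n"
        using diameter_bounded_bound[OF bU u(1,2)] by (simp add: d_def dist_real_def)
      moreover have "4 * g n = r n - d n" by (simp add: g_def)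
      ultimately show "\<bar>b - b'\<bar> \<le> r n" using u(3,4) by linarith
    qed
    also have "\<dots> = 2 * N * A * (\<Sum>n\<in>F. a n)" by (simp add: N_def ra)
    also have "\<dots> \<le> 2 * N * A * \<kappa>"
      using sum_a NA by (intro mult_left_mono) (auto simp: \<eta>_def)
    also have "\<dots> < (2 * N * A + 1) * \<kappa>" using \<kappa> by (simp add: distrib_right)
    also have "\<dots> = c" unfolding \<kappa>_def using add_nonneg_pos[OF NA zero_less_one] by simp
    finally show False by simp
  qed
  with \<theta>(1) that show thesis by blast
qed

end

text \<open>One ball around \<open>x0\<close> contains all of \<open>S\<close>, so
  \<open>upper\<close> bounds the size of every separated subset and a maximal one exists.\<close>

lemma (in plane_piece) ex_plane_net: "\<exists>Y. plane_net S \<alpha> A c Y"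
proof -
  have "\<exists>Y. finite Y \<and> Y \<subseteq> S \<and> separated ((1/2) ^ n) Y \<and> (\<forall>x\<in>S. \<exists>y\<in>Y. dist x y < (1/2) ^ n)" for n :: nat
  proof -
    obtain x0 B where B: "x0 \<in> S" "\<And>x. x \<in> S \<Longrightarrow> dist x0 x \<le> B"
      using compact_imp_bounded[OF compact] nonempty unfolding bounded_any_center[where a = "SOME x. x \<in> S"]
      by (metis some_in_eq)
    define r where "r = max B ((1/2) ^ n)"
    have "real (card Y) \<le> A * (r / (1/2) ^ n) powr \<alpha>"
      if "finite Y" "Y \<subseteq> S" "separated ((1/2) ^ n) Y" for Y
      using that B by (intro upper[of x0]) (auto simp: r_def le_max_iff_disj)
    then show ?thesis by (elim ex_separated_net[rotated]) (blast, simp)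
  qed
  then obtain Y where "\<And>n::nat. finite (Y n) \<and> Y n \<subseteq> S \<and> separated ((1/2) ^ n) (Y n) \<and> (\<forall>x\<in>S. \<exists>y\<in>Y n. dist x y < (1/2) ^ n)"
    by metis
  then have "plane_net S \<alpha> A c Y" by unfold_locales auto
  then show ?thesis by blast
qed

section \<open>Dimensions of the set of directions\<close>

lemma Theta_covers:
  obtains F :: "(real^2) set set" where "finite F" "card F \<le> 2 ^ (blk k + 1)" "dir ` Theta \<subseteq> \<Union>F"
    "\<And>U. U \<in> F \<Longrightarrow> bounded U \<and> diameter U \<le> (1/2) ^ gap (Suc k)"
proof -
  define w :: real where "w = (1/2) ^ gap (Suc k)"
  define U where "U i = dir ` {real i * (1/2) ^ blk k..real i * (1/2) ^ blk k + w}" for i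
  have dist_le: "dist x y \<le> w" if "x \<in> U i" "y \<in> U i" for i x y
    using that norm_dir_diff_le by (fastforce simp: U_def dist_norm intro: order_trans)
  have ne: "U i \<noteq> {}" for i by (simp add: U_def w_def)
  have "bounded (U i) \<and> diameter (U i) \<le> w" for i
  proof
    obtain x where "x \<in> U i" using ne by blast
    then show "bounded (U i)" using dist_le unfolding bounded_def by blast
    show "diameter (U i) \<le> w"
      using ne dist_le[of _ i] by (auto simp: diameter_def intro!: cSUP_least)
  qed
  moreover have "dir ` Theta \<subseteq> \<Union>(U ` {..2 ^ blk k})"
    unfolding Theta_eq U_def w_def by blast
  moreover have "card (U ` {..2 ^ blk k}) \<le> 2 ^ (blk k + 1)"
  proof -
    have "card (U ` {..2 ^ blk k}) \<le> card {..2 ^ blk k :: nat}" by (rule card_image_le) simp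
    also have "\<dots> \<le> 2 ^ (blk k + 1)" by simp
    finally show ?thesis .
  qed
  ultimately show thesis by (intro that[of "U ` {..2 ^ blk k}"]) (auto simp: w_def)
qed

lemma hausdorff_dim_dir_Theta: "hausdorff_dim (dir ` Theta) = 0"
proof -
  have "hausdorff_measure s (dir ` Theta) = 0" if s: "0 < s" for s
  proof (rule hausdorff_measure_null_finite_covers[OF s])
    fix \<epsilon> \<delta> :: real assume "0 < \<epsilon>" "0 < \<delta>"
    have "(\<lambda>n. (1/2::real) ^ n) \<longlonglongrightarrow> 0" by (rule LIMSEQ_realpow_zero) auto
    then have "\<forall>\<^sub>F k in sequentially. (1/2) ^ k < min \<epsilon> \<delta>"
      using \<open>0 < \<epsilon>\<close> \<open>0 < \<delta>\<close> by (intro order_tendstoD) auto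
    then have "\<forall>\<^sub>F k in sequentially. (1/2) ^ k < min \<epsilon> \<delta> \<and> nat \<lceil>3 / s\<rceil> \<le> k"
      using eventually_ge_at_top[of "nat \<lceil>3 / s\<rceil>"] by eventually_elim auto
    then obtain k where k: "(1/2) ^ k < min \<epsilon> \<delta>" "nat \<lceil>3 / s\<rceil> \<le> k"
      using eventually_happens'[OF sequentially_bot] by blast
    then have "3 / s \<le> real k" by linarith
    \<comment> \<open>Of the three multiples of \<open>blk k\<close> in the exponent, two pay for
      the number of windows and one makes the product small.\<close>
    then have sk: "3 \<le> s * (real k + 1)" using s by (simp add: pos_divide_le_eq field_simps)
    obtain F :: "(real^2) set set" where F: "finite F" "card F \<le> 2 ^ (blk k + 1)" "dir ` Theta \<subseteq> \<Union>F"
      "\<And>U. U \<in> F \<Longrightarrow> bounded U \<and> diameter U \<le> (1/2) ^ gap (Suc k)"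
      by (rule Theta_covers) blast
    have "k \<le> gap (Suc k)" using le_gap[of "Suc k"] by simp
    then have "(1/2::real) ^ gap (Suc k) \<le> (1/2) ^ k" by (intro power_decreasing) auto
    also have "\<dots> \<le> \<delta>" using k by simp
    finally have "(1/2) ^ gap (Suc k) \<le> \<delta>" .
    moreover have "real (card F) * ((1/2) ^ gap (Suc k)) powr s \<le> \<epsilon>"
    proof -
      have "real (card F) \<le> real (2 ^ (blk k + 1))" using F(2) by (simp only: of_nat_le_iff)
      also have "\<dots> = 2 powr (real (blk k) + 1)" by (simp add: powr_add powr_realpow)
      also have "\<dots> \<le> 2 powr (2 * real (blk k))" using blk_pos[of k] by (intro powr_mono) auto
      finally have "real (card F) * ((1/2) ^ gap (Suc k)) powr s \<le> 2 powr (2 * real (blk k)) * ((1/2) ^ gap (Suc k)) powr s"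
        by (intro mult_right_mono) auto
      also have "\<dots> = 2 powr (real (blk k) * (2 - s * (real k + 1)))"
        unfolding half_power_eq_powr powr_powr powr_add[symmetric] gap_Suc
        by (simp add: algebra_simps)
      also have "\<dots> \<le> 2 powr (real (blk k) * (- 1))"
        using sk by (intro powr_mono mult_left_mono) auto
      also have "\<dots> \<le> 2 powr (- real k)"
      proof -
        have "k \<le> blk k"
          using order_trans[OF fact_ge_self[of k] self_le_power[OF fact_ge_1, of 2]] by (simp add: blk_def)
        then show ?thesis by (intro powr_mono) auto
      qed
      also have "\<dots> \<le> \<epsilon>" using k(1) by (simp only: half_power_eq_powr[symmetric])
      finally show ?thesis .
    qed
    ultimately show "\<exists>\<rho> F. \<rho> \<le> \<delta> \<and> finite F \<and> dir ` Theta \<subseteq> \<Union>F \<and>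
        (\<forall>U\<in>F. bounded U \<and> diameter U \<le> \<rho>) \<and> real (card F) * \<rho> powr s \<le> \<epsilon>"
      using F(1,3,4) by blast
  qed
  then show ?thesis using hausdorff_dim_le[of 0 "dir ` Theta"] by simp
qed

text \<open>At scale 2^(-\<open>gap (Suc k)\<close>) about 2^(\<open>blk k\<close>) sets suffice,
  and the ratio of these exponents is 1/(k + 1). A lower limit is bounded by the values along this
  sequence of scales.\<close>

lemma lower_box_dim_dir_Theta: "lower_box_dim (dir ` Theta) = 0"
proof -
  let ?f = "\<lambda>\<delta>. ereal (ln (real (covering_number \<delta> (dir ` Theta))) / - ln \<delta>)"
  have "bounded (dir ` Theta)" unfolding bounded_iff by (auto intro: exI[of _ 1])
  then have eq: "lower_box_dim (dir ` Theta) = Liminf (at_right 0) ?f"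
    by (simp add: lower_box_dim_def)
  have "\<forall>\<^sub>F \<delta> in at_right 0. 0 \<le> ?f \<delta>"
    unfolding eventually_at_right_field
  proof (intro exI[of _ 1] conjI allI impI)
    fix \<delta> :: real assume "0 < \<delta>" "\<delta> < 1"
    then have "ln \<delta> < 0" by simp
    \<comment> \<open>For n = 0 the convention \<open>ln 0 = 0\<close> applies.\<close>
    moreover have "0 \<le> ln (real n)" for n by (cases "n = 0") auto
    ultimately show "0 \<le> ?f \<delta>" by (auto intro!: divide_nonneg_neg)
  qed simp
  then have "0 \<le> Liminf (at_right 0) ?f" by (rule Liminf_bounded)
  moreover have "Liminf (at_right 0) ?f \<le> 0"
    unfolding Liminf_def
  proof (rule SUP_least)
    fix P assume "P \<in> {P. eventually P (at_right (0::real))}"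
    then obtain b where b: "0 < b" "\<And>\<delta>. 0 < \<delta> \<Longrightarrow> \<delta> < b \<Longrightarrow> P \<delta>"
      by (auto simp: eventually_at_right_field)
    show "(INF \<delta>\<in>Collect P. ?f \<delta>) \<le> 0"
    proof (rule ereal_le_epsilon2)
      fix e :: real assume e: "0 < e"
      have "(\<lambda>n. (1/2::real) ^ n) \<longlonglongrightarrow> 0" by (rule LIMSEQ_realpow_zero) auto
      then have "\<forall>\<^sub>F k in sequentially. (1/2) ^ k < b"
        using b(1) by (intro order_tendstoD) auto
      then have "\<forall>\<^sub>F k in sequentially. (1/2) ^ k < b \<and> nat \<lceil>2 / e\<rceil> \<le> k"
        using eventually_ge_at_top[of "nat \<lceil>2 / e\<rceil>"] by eventually_elim auto
      then obtain k where k: "(1/2) ^ k < b" "nat \<lceil>2 / e\<rceil> \<le> k"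
        using eventually_happens'[OF sequentially_bot] by blast
      then have "2 / e \<le> real k" by linarith
      then have ek: "2 \<le> e * (real k + 1)" using e by (simp add: pos_divide_le_eq field_simps)
      define w :: real where "w = (1/2) ^ gap (Suc k)"
      have ln_w: "- ln w = real (gap (Suc k)) * ln 2"
        unfolding w_def half_power_eq_powr by (subst ln_powr) simp
      have "k \<le> gap (Suc k)" using le_gap[of "Suc k"] by simp
      then have "w \<le> (1/2) ^ k" unfolding w_def by (intro power_decreasing) auto
      then have "w < b" using k(1) by (rule order.strict_trans1)
      then have "P w" by (intro b(2)) (simp_all add: w_def)
      obtain F :: "(real^2) set set" where F: "finite F" "card F \<le> 2 ^ (blk k + 1)" "dir ` Theta \<subseteq> \<Union>F"
        "\<And>U. U \<in> F \<Longrightarrow> bounded U \<and> diameter U \<le> w"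
        unfolding w_def by (rule Theta_covers) blast
      define n where "n = covering_number w (dir ` Theta)"
      have "n \<le> card F"
        unfolding n_def covering_number_def using F by (intro cInf_lower) auto
      then have "n \<le> 2 ^ (blk k + 1)" using F(2) by linarith
      then have "real n \<le> real (2 ^ (blk k + 1))" by (rule of_nat_mono)
      then have n: "real n \<le> 2 ^ (blk k + 1)" unfolding of_nat_power of_nat_numeral .
      have "ln (real n) \<le> ln (2 ^ (blk k + 1))"
      proof (cases "n = 0")
        case True
        have "(1::real) \<le> 2 ^ (blk k + 1)" by (rule one_le_power) simp
        then show ?thesis unfolding True by (simp only: of_nat_0 ln_0 ln_ge_zero)
      next
        case False
        then show ?thesis using n by (intro ln_mono) auto
      qed
      also have "\<dots> = (real (blk k) + 1) * ln 2" by (subst ln_realpow) simp_all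
      also have "\<dots> \<le> (2 * real (blk k)) * ln 2"
        using blk_pos[of k] by (intro mult_right_mono) auto
      also have "\<dots> \<le> e * (real k + 1) * real (blk k) * ln 2"
        using ek by (intro mult_right_mono) auto
      also have "\<dots> = e * (- ln w)"
        unfolding ln_w by (simp add: gap_Suc algebra_simps)
      finally have "ln (real n) \<le> e * (- ln w)" .
      moreover have "0 < - ln w"
      proof -
        have "0 < gap (Suc k)" using le_gap[of "Suc k"] by simp
        then show ?thesis unfolding ln_w by simp
      qed
      ultimately have "ln (real n) / - ln w \<le> e" by (subst pos_divide_le_eq) auto
      then have "?f w \<le> 0 + ereal e" by (simp add: n_def)
      moreover have "(INF \<delta>\<in>Collect P. ?f \<delta>) \<le> ?f w" using \<open>P w\<close> by (intro INF_lower) simp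
      ultimately show "(INF \<delta>\<in>Collect P. ?f \<delta>) \<le> 0 + ereal e" by (rule order_trans[rotated])
    qed
  qed
  ultimately show ?thesis using eq by simp
qed

text \<open>The upper bound holds in every direction, since projections are 1-Lipschitz maps to the
  line. For the lower bound, a regular piece of \<open>E\<close> has a projection of dimension at
  least the minimum of \<open>\<alpha>\<close> and 1, while \<open>E\<close> has dimension at most
  \<open>\<alpha>\<close>.\<close>

lemma AD_regular_ex_direction:
  fixes E :: "(real^2) set"
  assumes "AD_regular E"
  obtains e where "e \<in> dir ` Theta" "hausdorff_dim ((\<lambda>x. e \<bullet> x) ` E) = min (hausdorff_dim E) 1"
proof -
  obtain \<alpha> C where AD: "AD_regular_with \<alpha> C E" using assms by (auto simp: AD_regular_def)
  have \<alpha>: "0 \<le> \<alpha>" using AD by (simp add: AD_regular_with_def)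
  have le: "hausdorff_dim ((\<lambda>x. dir \<theta> \<bullet> x) ` E) \<le> min (hausdorff_dim E) 1" for \<theta>
  proof -
    have "dist (dir \<theta> \<bullet> x) (dir \<theta> \<bullet> y) \<le> dist x y" for x y
      using Cauchy_Schwarz_ineq2[of "dir \<theta>" "x - y"] by (simp add: dist_norm inner_diff_right)
    then show ?thesis
      using hausdorff_dim_lipschitz[of "\<lambda>x. dir \<theta> \<bullet> x" E] hausdorff_dim_real_le_1 by simp
  qed
  show thesis
  proof (cases "0 < \<alpha> \<and> (\<exists>x0\<in>E. \<exists>x1\<in>E. x0 \<noteq> x1)")
    case True
    then obtain S A c where S: "S \<subseteq> E" "regular_piece S \<alpha> A c"
      using AD_regular_ex_piece[OF AD] by metis
    then interpret plane_piece S \<alpha> A c by (simp add: plane_piece_def)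
    obtain Y where "plane_net S \<alpha> A c Y" using ex_plane_net by blast
    then interpret plane_net S \<alpha> A c Y .
    obtain \<theta> where \<theta>: "\<theta> \<in> Theta"
      "\<And>t. 0 < t \<Longrightarrow> t < min \<alpha> 1 \<Longrightarrow> hausdorff_measure t ((\<lambda>x. dir \<theta> \<bullet> x) ` S) \<noteq> 0"
      by (rule ex_direction_positive_projection) blast
    have "ennreal (min \<alpha> 1) \<le> hausdorff_dim ((\<lambda>x. dir \<theta> \<bullet> x) ` E)"
    proof (rule le_hausdorff_dim)
      fix t assume "0 < t" "t < min \<alpha> 1"
      then show "hausdorff_measure t ((\<lambda>x. dir \<theta> \<bullet> x) ` E) \<noteq> 0"
        using \<theta>(2)[of t] hausdorff_measure_mono[OF image_mono[OF S(1)], of t "\<lambda>x. dir \<theta> \<bullet> x"] by auto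
    qed
    moreover have "min (hausdorff_dim E) 1 \<le> min (ennreal \<alpha>) (ennreal 1)"
      using AD_regular_with_dim_le[OF AD] by (intro min.mono) auto
    moreover have "min (ennreal \<alpha>) (ennreal 1) = ennreal (min \<alpha> 1)"
      using \<alpha> by (auto simp: min_def ennreal_le_iff simp flip: ennreal_1)
    ultimately have "min (hausdorff_dim E) 1 \<le> hausdorff_dim ((\<lambda>x. dir \<theta> \<bullet> x) ` E)"
      by (metis order_trans)
    then show ?thesis
      using le[of \<theta>] \<theta>(1) by (intro that[of "dir \<theta>"] antisym) auto
  next
    \<comment> \<open>If \<open>\<alpha>\<close> is 0 or \<open>E\<close> has at most one point, the
      dimension of \<open>E\<close> is 0 and every direction will do.\<close>
    case False
    then have "hausdorff_dim E \<le> ennreal 0"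
    proof (cases "\<alpha> = 0")
      case True
      then show ?thesis using AD_regular_with_dim_le[OF AD] by simp
    next
      case nz: False
      then show ?thesis
        using False \<alpha> by (intro hausdorff_dim_le hausdorff_measure_subsingleton) auto
    qed
    moreover have "0 \<in> Theta" unfolding Theta_def by (auto intro: exI[of _ 0])
    ultimately show ?thesis using le[of 0] by (intro that[of "dir 0"]) auto
  qed
qed

theorem theorem2:
  "\<exists>D\<^sub>0 :: (real^2) set.
     D\<^sub>0 \<subseteq> sphere 0 1 \<and> lower_box_dim D\<^sub>0 = 0 \<and> hausdorff_dim D\<^sub>0 = 0 \<and>
     universal D\<^sub>0 {E. AD_regular E}"
proof (intro exI conjI)
  show sphere: "dir ` Theta \<subseteq> sphere 0 1" by auto
  show "universal (dir ` Theta) {E. AD_regular E}"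
    unfolding universal_def
  proof (intro conjI sphere ballI)
    fix E :: "(real^2) set" assume "E \<in> {E. AD_regular E}"
    then have "AD_regular E" by simp
    then show "\<exists>e\<in>dir ` Theta. hausdorff_dim ((\<lambda>x. e \<bullet> x) ` E) = min (hausdorff_dim E) 1"
      by (rule AD_regular_ex_direction) blast
  qed
qed (fact lower_box_dim_dir_Theta hausdorff_dim_dir_Theta)+

end
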